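(* Let $h^{\mathrm{c}}\colon[1,2]\to[1,\infty]$ and $h\colon[1,3]\to[1,\infty]$ be non-increasing functions such that $h(k)\ge h^{\mathrm{c}}(k)$ for all $k\in[1,2]$ and $h^{\mathrm{c}}(2)=h(3)=1$. Then there exists a metric measure space $\mathfrak{Z}$ such that, for the associated modified maximal operators and every $p\in[1,\infty]$: - for every $k\in[1,2)$, $M_k^{\mathrm{c}}$ is of weak type $(p,p)$ if and only if $p>h^{\mathrm{c}}(k)$ or $p=\infty$; - for every $k\in[1,3)$, $M_k$ is of weak type $(p,p)$ if and only if $p>h(k)$ or $p=\infty$.
   Context: A metric measure space $(X,\rho,\mu)$ is a nonempty metric space $(X,\rho)$ with a Borel measure $\mu$; throughout, $(X,\rho)$ is bounded and separable, and every open ball $B(x,r)=\{y\in X:\rho(x,y)<r\}$ ($x\in X$, $r>0$) has finite and strictly positive measure. For $k\ge 1$ and measurable $f$, the modified Hardy--Littlewood maximal operators, centered and non-centered, are $$M_k^{\mathrm{c}}f(x)=\sup_{r>0}\frac{1}{\mu(B(x,kr))}\int_{B(x,r)}|f|\,d\mu,\qquad M_kf(x)=\sup_{(y,r):\,x\in B(y,r)}\frac{1}{\mu(B(y,kr))}\int_{B(y,r)}|f|\,d\mu,$$ the second supremum being over all centers $y\in X$ and radii $r>0$ with $x\in B(y,r)$. For $p\in[1,\infty)$, $\|g\|_{p,\infty}=\sup_{\lambda>0}\lambda\,\mu(\{x:|g(x)|>\lambda\})^{1/p}$, and $\|g\|_{\infty,\infty}=\|g\|_\infty$. An operator $T$ is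 of weak type $(p,p)$ if there is a finite constant $C$ with $\|Tf\|_{p,\infty}\le C\|f\|_p$ for all $f\in L^p(X,\mu)$. *)

theory Defs
  imports "HOL-Analysis.Analysis" "HOL-Probability.Essential_Supremum"
begin

text \<open>A separable metric space has at most continuum many points, so up to isometry every such
  space lives on a carrier \<open>X :: real set\<close> (with a metric \<open>\<rho>\<close> unrelated to the usual one).\<close>

locale metric_measure_space = Metric_space X \<rho>
  for X :: "'a set" and \<rho> :: "'a \<Rightarrow> 'a \<Rightarrow> real" +
  fixes \<mu> :: "'a measure"
  assumes nonempty: "X \<noteq> {}"
    and bounded: "mbounded X"
    and separable: "separable_space mtopology"
    and space_eq: "space \<mu> = X"
    and sets_eq: "sets \<mu> = sigma_sets X {U. openin mtopology U}"
    and ball_finite: "\<And>x r. x \<in> X \<Longrightarrow> r > 0 \<Longrightarrow> emeasure \<mu> (mball x r) < \<infinity>"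
    and ball_positive: "\<And>x r. x \<in> X \<Longrightarrow> r > 0 \<Longrightarrow> 0 < emeasure \<mu> (mball x r)"
begin

definition maximal_c :: "real \<Rightarrow> ('a \<Rightarrow> real) \<Rightarrow> 'a \<Rightarrow> ennreal" where
  "maximal_c k f x =
    (SUP r\<in>{0<..}. (\<integral>\<^sup>+y\<in>mball x r. ennreal \<bar>f y\<bar> \<partial>\<mu>) / emeasure \<mu> (mball x (k * r)))"

definition maximal :: "real \<Rightarrow> ('a \<Rightarrow> real) \<Rightarrow> 'a \<Rightarrow> ennreal" where
  "maximal k f x =
    (SUP (y, r)\<in>{(y, r). y \<in> X \<and> r > 0 \<and> x \<in> mball y r}.
      (\<integral>\<^sup>+z\<in>mball y r. ennreal \<bar>f z\<bar> \<partial>\<mu>) / emeasure \<mu> (mball y (k * r)))"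

end

text \<open>Real powers on \<open>[0, \<infinity>]\<close>; only used with exponents \<open>a > 0\<close>, so that
  \<open>\<infinity>\<close> raised to \<open>a\<close> is \<open>\<infinity>\<close>.\<close>

definition ennpowr :: "ennreal \<Rightarrow> real \<Rightarrow> ennreal" where
  "ennpowr t a = (if t = \<infinity> then \<infinity> else ennreal (enn2real t powr a))"

text \<open>The (quasi-)norms take \<open>[0, \<infinity>]\<close>-valued functions, to be thought of as absolute values,
  because maximal functions may be infinite. Exponents \<open>p\<close> range over \<open>[1, \<infinity>]\<close>.\<close>

definition Lp_norm :: "'a measure \<Rightarrow> ennreal \<Rightarrow> ('a \<Rightarrow> ennreal) \<Rightarrow> ennreal" where
  "Lp_norm M p g =
    (if p = \<infinity> then esssup M g
     else ennpowr (\<integral>\<^sup>+x. ennpowr (g x) (enn2real p) \<partial>M) (1 / enn2real p))"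

definition weak_Lp_norm :: "'a measure \<Rightarrow> ennreal \<Rightarrow> ('a \<Rightarrow> ennreal) \<Rightarrow> ennreal" where
  "weak_Lp_norm M p g =
    (if p = \<infinity> then Lp_norm M \<infinity> g
     else (SUP t\<in>{0::real<..}.
       ennreal t * ennpowr (emeasure M {x \<in> space M. g x > ennreal t}) (1 / enn2real p)))"

definition Lp :: "'a measure \<Rightarrow> ennreal \<Rightarrow> ('a \<Rightarrow> real) set" where
  "Lp M p = {f \<in> borel_measurable M. Lp_norm M p (\<lambda>x. ennreal \<bar>f x\<bar>) < \<infinity>}"

definition weak_type ::
    "'a measure \<Rightarrow> ennreal \<Rightarrow> (('a \<Rightarrow> real) \<Rightarrow> 'a \<Rightarrow> ennreal) \<Rightarrow> bool" where
  "weak_type M p T \<longleftrightarrow>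
    (\<exists>C<\<infinity>. \<forall>f\<in>Lp M p. weak_Lp_norm M p (T f) \<le> C * Lp_norm M p (\<lambda>x. ennreal \<bar>f x\<bar>))"

end

theory Submission
  imports Defs
begin

text \<open>The space is a countable disjoint union of finite blocks at mutual distance 4. Block \<open>t\<close> is a star:
  a hub of mass \<open>c\<close>, and \<open>N\<close> arms, each consisting of a light midpoint of mass \<open>c / N\<close> and a
  heavy leaf of mass \<open>c * W\<close>. For \<open>k < b\<close> there are balls of radius slightly above 1 that contain
  the hub and one leaf and whose \<open>k\<close>-dilation still meets no other leaf; they are centered at
  the leaf itself (so they count for the centered operator, which needs \<open>b \<le> 2\<close>) or only at the
  midpoint (then they matter only for the non-centered operator, and \<open>b \<le> 3\<close> is possible). Testing
  with the indicator of the hub gives a weak type \<open>(p, p)\<close> constant of at least about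
  \<open>N powr (1/p) * W powr (1/p - 1)\<close>, which for \<open>N\<close> about \<open>W powr (P - 1)\<close> is \<open>W powr (P/p - 1)\<close>:
  large for \<open>p < P\<close> and bounded for \<open>p \<ge> P\<close>. All other balls are harmless, uniformly in the block.

  The given function is approximated by step functions that are right continuous, because
  a single block is bad exactly on a half-open interval \<open>k < b\<close>. A sequence of
  thresholds \<open>(b, P)\<close> is chosen such that \<open>k < b\<close> and \<open>p < P\<close> hold for only finitely many blocks if
  \<open>p\<close> exceeds the function at \<open>k\<close>, and for infinitely many blocks with a quantitative gap otherwise.\<close>

section \<open>Approximation of monotone functions by thresholds\<close>

text \<open>Rationals alone do not suffice: \<open>g\<close> may drop exactly at an irrational
  point, and no rational to the left of it sees the lower value. Such a point is the least element
  of a sublevel set \<open>g < q\<close> with \<open>q\<close> rational, so countably many extra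
  points repair this. A sublevel set that contains \<open>k\<close> and has no least element
  contains a rational below \<open>k\<close>.\<close>

lemma countable_left_dense_sublevels:
  fixes g :: "real \<Rightarrow> ennreal"
  assumes anti: "antimono_on {a..<e} g"
  obtains S where "countable S" "S \<subseteq> {a..<e}" "a < e \<Longrightarrow> S \<noteq> {}"
    "\<And>k p. k \<in> {a..<e} \<Longrightarrow> g k < p \<Longrightarrow> \<exists>s\<in>S. s \<le> k \<and> g s < p"
proof
  define m where "m q = (SOME z. z \<in> {a..<e} \<and> g z < ennreal q \<and> (\<forall>y\<in>{a..<e}. g y < ennreal q \<longrightarrow> z \<le> y))" for q :: real
  \<comment> \<open>\<open>m q\<close> is arbitrary if the sublevel set has no least element; then rationals serve instead.\<close>
  let ?S = "(insert a (m ` \<rat> \<union> \<rat>)) \<inter> {a..<e}"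
  show "countable ?S" by (simp add: countable_rat)
  show "?S \<subseteq> {a..<e}" by simp
  show "?S \<noteq> {}" if "a < e" using that by auto
  fix k p assume k: "k \<in> {a..<e}" and p: "g k < p"
  obtain r where r: "g k < ennreal r" "ennreal r < p" "0 \<le> r"
    using p by (metis dense ennreal_cases not_less_iff_gr_or_eq top.not_eq_extremum)
  obtain r' where r': "r' < r" "g k < ennreal r'"
    using dense[OF r(1)] by (metis (full_types) enn2real_nonneg ennreal_enn2real ennreal_less_top ennreal_less_iff order.strict_trans)
  obtain q where q: "q \<in> \<rat>" "r' < q" "q < r" using Rats_dense_in_real[OF r'(1)] by blast
  have kq: "g k < ennreal q" using r'(2) q(2) by (meson ennreal_leI less_imp_le order_less_le_trans)
  have qp: "ennreal q < p" using r q by (meson ennreal_leI less_imp_le order_le_less_trans)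
  show "\<exists>s\<in>?S. s \<le> k \<and> g s < p"
  proof (cases "\<exists>z. z \<in> {a..<e} \<and> g z < ennreal q \<and> (\<forall>y\<in>{a..<e}. g y < ennreal q \<longrightarrow> z \<le> y)")
    case True
    then have *: "m q \<in> {a..<e} \<and> g (m q) < ennreal q \<and> (\<forall>y\<in>{a..<e}. g y < ennreal q \<longrightarrow> m q \<le> y)"
      unfolding m_def by (rule someI_ex)
    show ?thesis
      by (rule bexI[of _ "m q"]) (use * q k kq qp in auto)
  next
    case False
    then obtain y where y: "y \<in> {a..<e}" "g y < ennreal q" "y < k"
      using k kq by (meson not_le)
    obtain z where z: "z \<in> \<rat>" "y < z" "z < k" using Rats_dense_in_real[OF y(3)] by blast
    have "g z \<le> g y" using anti y z k by (auto simp: monotone_on_def)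
    then show ?thesis
      by (intro bexI[of _ z]) (use z y k qp in auto)
  qed
qed

text \<open>Each \<open>t\<close> encodes one stair of a staircase: a resolution \<open>m t\<close>
  and a grid point \<open>s (i t)\<close> among the first \<open>m t + 1\<close>. The stair ends at
  the next grid point \<open>b t\<close>, and its height \<open>P t\<close> is the value of
  \<open>g\<close> at its left end, truncated and slightly raised. As \<open>g\<close> is
  non-increasing, it does no harm that the condition \<open>k < b t\<close> ignores where the stair
  starts.\<close>

lemma step_approximation:
  fixes g :: "real \<Rightarrow> ennreal"
  assumes anti: "antimono_on {1..<e} g" and e: "1 < e" and ge1: "\<forall>k\<in>{1..<e}. 1 \<le> g k"
  obtains b P d :: "nat \<Rightarrow> real" where
    "\<And>t. 1 < b t" "\<And>t. b t \<le> e" "\<And>t. 1 < P t" "\<And>t. 0 < d t"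
    "\<And>k p. k \<in> {1..<e} \<Longrightarrow> g k < ennreal p \<Longrightarrow> finite {t. k < b t \<and> p < P t}"
    "\<And>k p n. k \<in> {1..<e} \<Longrightarrow> ennreal p \<le> g k \<Longrightarrow> \<exists>t\<ge>n. k < b t \<and> p + d t \<le> P t"
proof -
  obtain S where S: "countable S" "S \<subseteq> {1..<e}" "S \<noteq> {}"
    and S_dense: "\<And>k p. k \<in> {1..<e} \<Longrightarrow> g k < p \<Longrightarrow> \<exists>s\<in>S. s \<le> k \<and> g s < p"
    using countable_left_dense_sublevels[OF anti] e by metis
  \<comment> \<open>With 1 in the grid, every \<open>k\<close> has a grid point at or below it once
    the resolution is large.\<close>
  define s where "s = from_nat_into (insert 1 S)"
  have range_s: "range s = insert 1 S"
    unfolding s_def using S by (intro range_from_nat_into) auto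
  have s_in: "s i \<in> {1..<e}" for i
    using range_s S e by (metis atLeastLessThan_iff insert_iff order_refl rangeI subsetD)
  \<comment> \<open>The maximum ensures \<open>i t \<le> m t\<close>, and a bound on
    \<open>m t\<close> leaves only finitely many \<open>t\<close>.\<close>
  define m where "m t = max (fst (prod_decode t)) (snd (prod_decode t))" for t
  define i where "i t = snd (prod_decode t)" for t
  define A where "A n z = insert e {s j |j. j \<le> n \<and> z < s j}" for n z
  define b where "b t = Min (A (m t) (s (i t)))" for t
  \<comment> \<open>The truncation copes with infinite values of \<open>g\<close>. The increment
    makes \<open>P t > 1\<close> strict and provides the gap \<open>d t\<close> in the borderline
    case \<open>p = g k\<close>.\<close>
  define P where "P t = enn2real (min (g (s (i t))) (of_nat (Suc (m t)))) + 1 / Suc (m t)" for t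
  define d where "d t = 1 / real (Suc (m t))" for t
  have fin_A [simp]: "finite (A n z)" and A_ne [simp]: "A n z \<noteq> {}" for n z
    by (auto simp: A_def)
  have P_cut: "ennreal (enn2real (min x (of_nat (Suc n)))) = min x (of_nat (Suc n))" for x :: ennreal and n
    by (rule ennreal_enn2real) (auto simp: min_less_iff_disj of_nat_less_top simp del: of_nat_Suc)
  show thesis
  proof
    show "1 < b t" for t
      using e s_in[of "i t"] by (auto simp: b_def A_def)
    show "b t \<le> e" for t
      unfolding b_def by (rule Min_le) (simp_all add: A_def)
    show "0 < d t" for t by (simp add: d_def)
    show "1 < P t" for t
    proof -
      have "1 \<le> min (g (s (i t))) (of_nat (Suc (m t)))"
        using bspec[OF ge1 s_in[of "i t"]] by (simp del: of_nat_Suc)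
      then have "1 \<le> enn2real (min (g (s (i t))) (of_nat (Suc (m t))))"
        by (subst (asm) P_cut[symmetric]) (simp del: of_nat_Suc)
      then show ?thesis unfolding P_def by (smt (verit) divide_pos_pos of_nat_0_less_iff zero_less_Suc)
    qed
  next
    fix k p assume k: "k \<in> {1..<e}" and p: "g k < ennreal p"
    obtain p' where p': "g k < ennreal p'" "p' < p" "0 \<le> p'"
      using dense[OF p] by (metis enn2real_nonneg ennreal_enn2real ennreal_less_iff ennreal_less_top order.strict_trans)
    obtain i0 where i0: "s i0 \<le> k" "g (s i0) < ennreal p'"
      using S_dense[OF k p'(1)] range_s by (metis imageE insertI2)
    obtain n0 where n0: "1 / real (Suc n0) < p - p'" using p'(2) nat_approx_posE[of "p-p'"]
      by (metis diff_gt_0_iff_gt)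
    \<comment> \<open>A fine grid contains \<open>s i0\<close>. A stair starting left of
      \<open>s i0\<close> ends there at the latest, hence not beyond \<open>k\<close>; any other
      stair has height at most \<open>p' + 1 / Suc n0 < p\<close>.\<close>
    have "m t \<le> max i0 n0" if t: "k < b t" "p < P t" for t
    proof (rule ccontr)
      assume "\<not> m t \<le> max i0 n0"
      then have mt: "i0 < m t" "n0 < m t" by auto
      have "s i0 \<le> s (i t)"
      proof (rule ccontr)
        assume "\<not> s i0 \<le> s (i t)"
        then have "b t \<le> s i0" unfolding b_def by (intro Min_le) (use mt in \<open>auto simp: A_def\<close>)
        then show False using i0 t by simp
      qed
      then have "g (s (i t)) \<le> g (s i0)" using anti s_in by (auto simp: monotone_on_def)
      then have "min (g (s (i t))) (of_nat (Suc (m t))) \<le> ennreal p'"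
        using i0(2) by (auto simp: min_le_iff_disj)
      then have "enn2real (min (g (s (i t))) (of_nat (Suc (m t)))) \<le> p'"
        using p'(3) by (metis enn2real_leI)
      moreover have "1 / real (Suc (m t)) \<le> 1 / real (Suc n0)"
        using mt by (intro divide_left_mono) auto
      ultimately have "P t \<le> p" using n0 unfolding P_def by linarith
      then show False using t by simp
    qed
    then have "{t. k < b t \<and> p < P t} \<subseteq> prod_encode ` ({..max i0 n0} \<times> {..max i0 n0})"
      by (auto simp: m_def image_iff Bex_def) (metis max.bounded_iff prod.collapse prod_decode_inverse)
    then show "finite {t. k < b t \<and> p < P t}" by (rule finite_subset) simp
  next
    fix k p n assume k: "k \<in> {1..<e}" and p: "ennreal p \<le> g k"
    obtain i1 where i1: "s i1 = 1" using range_s by (metis imageE insertI1)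
    obtain n1 where n1: "p \<le> real n1" using real_arch_simple by blast
    define M where "M = max n (max i1 n1)"
    define Z where "Z = {s j |j. j \<le> M \<and> s j \<le> k}"
    have Z: "finite Z" "Z \<noteq> {}" using i1 k by (auto simp: Z_def M_def intro!: exI[of _ i1])
    then have "Max Z \<in> Z" by (rule Max_in)
    then obtain j where j: "Max Z = s j" "j \<le> M" "s j \<le> k" unfolding Z_def by blast
    \<comment> \<open>This is the stair over \<open>k\<close> at resolution \<open>M\<close>: it
      starts at the last grid point not exceeding \<open>k\<close>.\<close>
    define t where "t = prod_encode (M, j)"
    have mt: "m t = M" and it: "i t = j" using j by (auto simp: t_def m_def i_def)
    have "n \<le> t" unfolding t_def by (rule order_trans[OF _ le_prod_encode_1]) (simp add: M_def)
    moreover have "k < b t"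
    proof -
      have "k < x" if "x \<in> A M (s j)" for x
      proof (rule ccontr)
        assume "\<not> k < x"
        then have "x \<in> Z" "s j < x" using that k by (auto simp: A_def Z_def)
        then show False using Max_ge[OF Z(1)] j(1) by fastforce
      qed
      then show ?thesis by (simp add: b_def mt it)
    qed
    moreover have "p + d t \<le> P t"
    proof -
      have "g k \<le> g (s j)" using anti s_in[of j] k j by (auto simp: monotone_on_def)
      then have "ennreal p \<le> g (s j)" using p by simp
      moreover have "ennreal p \<le> of_nat (Suc M)"
        using n1 unfolding ennreal_of_nat_eq_real_of_nat M_def by (intro ennreal_leI) linarith
      ultimately have "ennreal p \<le> ennreal (enn2real (min (g (s j)) (of_nat (Suc M))))"
        unfolding P_cut by simp
      then show ?thesis by (simp add: P_def d_def mt it ennreal_le_iff del: of_nat_Suc)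
    qed
    ultimately show "\<exists>t\<ge>n. k < b t \<and> p + d t \<le> P t" by blast
  qed
qed

section \<open>Averages and weak type bounds\<close>

text \<open>A substitute for Jensen's inequality: \<open>\<bar>f\<bar> \<le> \<tau>/2 + (\<tau>/2) powr (1 - q) * \<bar>f\<bar> powr q\<close> pointwise. It turns a
  large average of \<open>f\<close> over a ball into a large average of \<open>\<bar>f\<bar> powr q\<close>, so that harmless balls
  need only be treated for \<open>q = 1\<close>.\<close>

lemma nn_integral_powr_lower_bound:
  fixes f :: "'a \<Rightarrow> real"
  assumes f [measurable]: "f \<in> borel_measurable M" and A [measurable]: "A \<in> sets M"
    and q: "1 \<le> q" and \<tau>: "0 < \<tau>" and m: "0 \<le> m" "emeasure M A \<le> ennreal m"
    and big: "ennreal \<tau> * ennreal m < (\<integral>\<^sup>+x\<in>A. ennreal \<bar>f x\<bar> \<partial>M)"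
  shows "ennreal ((\<tau> / 2) powr q * m) \<le> (\<integral>\<^sup>+x\<in>A. ennreal (\<bar>f x\<bar> powr q) \<partial>M)"
proof (cases "(\<integral>\<^sup>+x\<in>A. ennreal (\<bar>f x\<bar> powr q) \<partial>M)")
  case (real j)
  define c where "c = (\<tau> / 2) powr (1 - q)"
  have c: "0 < c" using \<tau> by (simp add: c_def)
  have pointwise: "\<bar>y\<bar> \<le> \<tau> / 2 + c * \<bar>y\<bar> powr q" for y :: real
  proof (cases "\<bar>y\<bar> \<le> \<tau> / 2")
    case False
    have "\<bar>y\<bar> powr (1 - q) \<le> (\<tau> / 2) powr (1 - q)"
      using False q \<tau> by (intro powr_mono2') auto
    then have "\<bar>y\<bar> powr (1 - q) * \<bar>y\<bar> powr q \<le> c * \<bar>y\<bar> powr q"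
      unfolding c_def by (intro mult_right_mono) auto
    moreover have "\<bar>y\<bar> powr (1 - q) * \<bar>y\<bar> powr q = \<bar>y\<bar>"
      using False \<tau> by (simp flip: powr_add)
    ultimately show ?thesis using \<tau> by simp
  next
    case True
    moreover have "0 \<le> c * \<bar>y\<bar> powr q" using c by simp
    ultimately show ?thesis by linarith
  qed
  have "(\<integral>\<^sup>+x\<in>A. ennreal \<bar>f x\<bar> \<partial>M)
      \<le> (\<integral>\<^sup>+x. ennreal (\<tau> / 2) * indicator A x + ennreal c * (ennreal (\<bar>f x\<bar> powr q) * indicator A x) \<partial>M)"
    using \<tau> c pointwise
    by (intro nn_integral_mono) (auto simp: indicator_def ennreal_leI simp flip: ennreal_mult' ennreal_plus)
  also have "\<dots> = ennreal (\<tau> / 2) * emeasure M A + ennreal c * (\<integral>\<^sup>+x\<in>A. ennreal (\<bar>f x\<bar> powr q) \<partial>M)"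
    by (simp add: nn_integral_add nn_integral_cmult)
  also have "\<dots> \<le> ennreal (\<tau> / 2) * ennreal m + ennreal c * ennreal j"
    using m real by (intro add_mono mult_left_mono) auto
  also have "\<dots> = ennreal (\<tau> / 2 * m + c * j)"
    using \<tau> m c real by (simp flip: ennreal_mult ennreal_plus)
  finally have "ennreal (\<tau> * m) < ennreal (\<tau> / 2 * m + c * j)"
    using big \<tau> by (simp add: ennreal_mult' order_less_le_trans)
  then have "\<tau> * m < \<tau> / 2 * m + c * j" using \<tau> m by (simp add: ennreal_less_iff)
  then have "(\<tau> / 2) powr (q - 1) * (\<tau> / 2 * m) \<le> (\<tau> / 2) powr (q - 1) * (c * j)"
    by (intro mult_left_mono) auto
  moreover have "(\<tau> / 2) powr (q - 1) * (\<tau> / 2) = (\<tau> / 2) powr q"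
    using \<tau> by (simp add: powr_diff)
  moreover have "(\<tau> / 2) powr (q - 1) * c = 1"
    using \<tau> by (simp add: c_def flip: powr_add)
  ultimately have "(\<tau> / 2) powr q * m \<le> j"
    by (metis mult.assoc mult_1)
  then show ?thesis using real by (simp add: ennreal_leI)
qed (simp add: top_unique)

section \<open>Maximal operators and averages over balls\<close>

context metric_measure_space
begin

lemma emeasure_mball_pos_finite:
  assumes "x \<in> X" "0 < r"
  shows "0 < emeasure \<mu> (mball x r)" "emeasure \<mu> (mball x r) < \<infinity>" "mball x r \<in> sets \<mu>"
proof -
  show "0 < emeasure \<mu> (mball x r)" "emeasure \<mu> (mball x r) < \<infinity>"
    using ball_positive ball_finite assms by auto
  then show "mball x r \<in> sets \<mu>" using emeasure_notin_sets by force
qed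

lemma less_divide_mball:
  assumes "y \<in> X" "0 < r" "\<tau> < I / emeasure \<mu> (mball y r)"
  shows "\<tau> * emeasure \<mu> (mball y r) < I"
proof (rule ccontr)
  assume "\<not> \<tau> * emeasure \<mu> (mball y r) < I"
  then have "I / emeasure \<mu> (mball y r) \<le> \<tau>"
    using emeasure_mball_pos_finite[OF assms(1,2)]
    by (intro divide_le_posI_ennreal) (auto simp: not_less mult.commute)
  then show False using assms(3) by simp
qed

text \<open>A division-free upper estimate shared by both maximal operators, so that positive
  results are proved only once; \<open>cen\<close> restricts the witnessing balls to those centered
  at \<open>x\<close>.\<close>

definition ball_dominated :: "bool \<Rightarrow> real \<Rightarrow> (('a \<Rightarrow> real) \<Rightarrow> 'a \<Rightarrow> ennreal) \<Rightarrow> bool" where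
  "ball_dominated cen k T \<longleftrightarrow> (\<forall>f. \<forall>x\<in>X. \<forall>\<tau>. \<tau> < T f x \<longrightarrow>
    (\<exists>y\<in>X. \<exists>r>0. x \<in> mball y r \<and> (cen \<longrightarrow> y = x) \<and>
      \<tau> * emeasure \<mu> (mball y (k * r)) < (\<integral>\<^sup>+z\<in>mball y r. ennreal \<bar>f z\<bar> \<partial>\<mu>)))"

lemma ball_dominatedD:
  assumes "ball_dominated cen k T" "x \<in> X" "\<tau> < T f x"
  obtains y r where "y \<in> X" "0 < r" "x \<in> mball y r" "cen \<Longrightarrow> y = x"
    "\<tau> * emeasure \<mu> (mball y (k * r)) < (\<integral>\<^sup>+z\<in>mball y r. ennreal \<bar>f z\<bar> \<partial>\<mu>)"
  using assms unfolding ball_dominated_def by meson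

lemma ball_dominated_maximal:
  assumes "1 \<le> k"
  shows "ball_dominated False k (maximal k)"
  unfolding ball_dominated_def maximal_def less_SUP_iff
  using assms by (fastforce intro!: less_divide_mball)

lemma ball_dominated_maximal_c:
  assumes "1 \<le> k"
  shows "ball_dominated True k (maximal_c k)"
  unfolding ball_dominated_def maximal_c_def less_SUP_iff
  using assms by (fastforce intro!: less_divide_mball)

lemma le_maximal:
  assumes "y \<in> X" "0 < r" "x \<in> mball y r"
  shows "(\<integral>\<^sup>+z\<in>mball y r. ennreal \<bar>f z\<bar> \<partial>\<mu>) / emeasure \<mu> (mball y (k * r)) \<le> maximal k f x"
  unfolding maximal_def using assms by (intro SUP_upper2[of "(y, r)"]) auto

lemma le_maximal_c:
  assumes "0 < r"
  shows "(\<integral>\<^sup>+z\<in>mball x r. ennreal \<bar>f z\<bar> \<partial>\<mu>) / emeasure \<mu> (mball x (k * r)) \<le> maximal_c k f x"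
  unfolding maximal_c_def using assms by (intro SUP_upper2[of r]) auto

text \<open>For \<open>k \<ge> 1\<close> the ball in the denominator contains the ball of
  integration, so no average exceeds an essential bound of the function.\<close>

lemma ball_dominated_le_bound:
  assumes T: "ball_dominated cen k T" and k: "1 \<le> k" and x: "x \<in> X"
    and f: "AE x in \<mu>. ennreal \<bar>f x\<bar> \<le> c"
  shows "T f x \<le> c"
proof (rule ccontr)
  assume "\<not> T f x \<le> c"
  then have "c < T f x" by simp
  then obtain y r where yr: "y \<in> X" "0 < r" "x \<in> mball y r"
    "c * emeasure \<mu> (mball y (k * r)) < (\<integral>\<^sup>+z\<in>mball y r. ennreal \<bar>f z\<bar> \<partial>\<mu>)"
    using ball_dominatedD[OF T x] by metis
  have "(\<integral>\<^sup>+z\<in>mball y r. ennreal \<bar>f z\<bar> \<partial>\<mu>) \<le> (\<integral>\<^sup>+z\<in>mball y r. c \<partial>\<mu>)"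
    using f by (intro nn_integral_mono_AE) (auto simp: indicator_def)
  also have "\<dots> = c * emeasure \<mu> (mball y r)"
    using emeasure_mball_pos_finite(3)[OF yr(1,2)] by (simp add: nn_integral_cmult_indicator)
  also have "\<dots> \<le> c * emeasure \<mu> (mball y (k * r))"
    using yr k emeasure_mball_pos_finite(3)[of y "k * r"]
    by (intro mult_left_mono emeasure_mono mball_subset_concentric) auto
  finally show False using yr by simp
qed

end

section \<open>Criteria for weak type\<close>

lemma weak_type_infinityI:
  assumes "\<And>f. f \<in> borel_measurable M \<Longrightarrow> T f \<in> borel_measurable M"
    and "\<And>f x c. x \<in> space M \<Longrightarrow> AE x in M. ennreal \<bar>f x\<bar> \<le> c \<Longrightarrow> T f x \<le> c"
  shows "weak_type M \<infinity> T"
  unfolding weak_type_def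
proof (intro exI[of _ 1] conjI ballI)
  fix f assume "f \<in> Lp M \<infinity>"
  then have f [measurable]: "f \<in> borel_measurable M" by (simp add: Lp_def)
  have "AE x in M. ennreal \<bar>f x\<bar> \<le> esssup M (\<lambda>x. ennreal \<bar>f x\<bar>)"
    by (rule esssup_AE)
  then have "esssup M (T f) \<le> esssup M (\<lambda>x. ennreal \<bar>f x\<bar>)"
    using assms f by (intro esssup_I AE_I2) auto
  then show "weak_Lp_norm M \<infinity> (T f) \<le> 1 * Lp_norm M \<infinity> (\<lambda>x. ennreal \<bar>f x\<bar>)"
    by (simp add: weak_Lp_norm_def Lp_norm_def)
qed simp

lemma ennpowr_ennreal [simp]: "0 \<le> x \<Longrightarrow> ennpowr (ennreal x) a = ennreal (x powr a)"
  by (simp add: ennpowr_def)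

text \<open>The norm inequality is the \<open>q\<close>-th root of the level set estimate. Roots are
  taken in the reals: \<open>f \<in> Lp\<close> makes the integral finite, and the estimate then
  makes the level set finite.\<close>

lemma weak_typeI:
  fixes q C :: real
  assumes q: "1 \<le> q" and C: "0 \<le> C"
    and level: "\<And>f \<tau>. f \<in> borel_measurable M \<Longrightarrow> 0 < \<tau> \<Longrightarrow>
      ennreal (\<tau> powr q) * emeasure M {x \<in> space M. ennreal \<tau> < T f x}
        \<le> ennreal C * (\<integral>\<^sup>+x. ennreal (\<bar>f x\<bar> powr q) \<partial>M)"
  shows "weak_type M (ennreal q) T"
  unfolding weak_type_def
proof (intro exI[of _ "ennreal (C powr (1 / q))"] conjI ballI)
  fix f assume "f \<in> Lp M (ennreal q)"
  then have f: "f \<in> borel_measurable M" and fin: "Lp_norm M (ennreal q) (\<lambda>x. ennreal \<bar>f x\<bar>) < \<infinity>"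
    by (auto simp: Lp_def)
  define J where "J = (\<integral>\<^sup>+x. ennreal (\<bar>f x\<bar> powr q) \<partial>M)"
  have norm: "Lp_norm M (ennreal q) (\<lambda>x. ennreal \<bar>f x\<bar>) = ennpowr J (1 / q)"
    using q by (simp add: Lp_norm_def J_def)
  then have "J \<noteq> \<infinity>" using fin by (auto simp: ennpowr_def)
  then obtain j where j: "0 \<le> j" "J = ennreal j" by (cases J) auto
  have "ennreal \<tau> * ennpowr (emeasure M {x \<in> space M. ennreal \<tau> < T f x}) (1 / q)
      \<le> ennreal (C powr (1 / q)) * ennreal (j powr (1 / q))" if \<tau>: "0 < \<tau>" for \<tau>
  proof -
    let ?E = "emeasure M {x \<in> space M. ennreal \<tau> < T f x}"
    have *: "ennreal (\<tau> powr q) * ?E \<le> ennreal (C * j)"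
      using level[OF f \<tau>] j C unfolding J_def[symmetric] by (simp add: ennreal_mult)
    have "?E \<noteq> \<infinity>"
    proof
      assume "?E = \<infinity>"
      then show False using * \<tau> by (simp add: ennreal_mult_eq_top_iff top_unique)
    qed
    then obtain m where m: "0 \<le> m" "?E = ennreal m" by (cases ?E) auto
    have "\<tau> powr q * m \<le> C * j"
      using * m \<tau> C j by (simp add: ennreal_le_iff flip: ennreal_mult)
    then have "(\<tau> powr q * m) powr (1 / q) \<le> (C * j) powr (1 / q)"
      using m q by (intro powr_mono2) auto
    then have "\<tau> * m powr (1 / q) \<le> C powr (1 / q) * j powr (1 / q)"
      using \<tau> m C j q by (simp add: powr_mult powr_powr)
    then show ?thesis
      using m \<tau> by (simp add: ennreal_leI flip: ennreal_mult)
  qed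
  then show "weak_Lp_norm M (ennreal q) (T f)
      \<le> ennreal (C powr (1 / q)) * Lp_norm M (ennreal q) (\<lambda>x. ennreal \<bar>f x\<bar>)"
    unfolding norm using q j by (auto simp: weak_Lp_norm_def intro!: SUP_least)
qed simp

section \<open>Star-shaped blocks\<close>

datatype pt = Hub nat | Mid nat nat | Leaf nat nat

instance pt :: countable by countable_datatype

fun block_of :: "pt \<Rightarrow> nat" where
  "block_of (Hub t) = t" | "block_of (Mid t i) = t" | "block_of (Leaf t i) = t"

text \<open>\<open>central t\<close> marks the blocks in which also balls centered at a leaf are bad.\<close>

locale star_blocks =
  fixes N :: "nat \<Rightarrow> nat" and W b :: "nat \<Rightarrow> real" and central :: "nat \<Rightarrow> bool"
  assumes N_pos: "0 < N t" and W_ge_1: "1 \<le> W t"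
    and b_gt_1: "1 < b t" and b_le_3: "b t \<le> 3" and central_b_le_2: "central t \<Longrightarrow> b t \<le> 2"
begin

text \<open>Only meant for distinct points of the same block; the last equation is never used.\<close>

fun near :: "pt \<Rightarrow> pt \<Rightarrow> real" where
  "near (Hub t) (Mid _ _) = 1"
| "near (Mid t _) (Hub _) = 1"
| "near (Hub t) (Leaf _ _) = (if central t then 1 else min (b t) 2)"
| "near (Leaf t _) (Hub _) = (if central t then 1 else min (b t) 2)"
| "near (Mid t i) (Leaf _ j) = (if i = j then 1 else b t)"
| "near (Leaf t i) (Mid _ j) = (if i = j then 1 else b t)"
| "near (Mid t _) (Mid _ _) = min (b t) 2"
| "near (Leaf t _) (Leaf _ _) = min (b t) 2"
| "near (Hub t) (Hub _) = 0"

text \<open>The value 4 exceeds all distances inside a block: balls of radius at most 4 stay in one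
  block, and balls of larger radius are the whole space.\<close>

definition D :: "pt \<Rightarrow> pt \<Rightarrow> real" where
  "D p q = (if p = q then 0 else if block_of p \<noteq> block_of q then 4 else near p q)"

lemma near_commute: "block_of p = block_of q \<Longrightarrow> near p q = near q p"
  by (cases p; cases q) auto

lemma D_commute: "D p q = D q p"
  using near_commute by (auto simp: D_def)

lemma near_bounds: "block_of p = block_of q \<Longrightarrow> p \<noteq> q \<Longrightarrow> 1 \<le> near p q \<and> near p q \<le> 3"
  using b_gt_1 b_le_3 by (cases p; cases q) (auto simp: min_def less_imp_le)

lemma D_ge_1: "p \<noteq> q \<Longrightarrow> 1 \<le> D p q"
  using near_bounds by (auto simp: D_def)

lemma D_le_4: "D p q \<le> 4"
  using near_bounds[of p q] by (auto simp: D_def)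

lemma D_le_3: "block_of p = block_of q \<Longrightarrow> D p q \<le> 3"
  using near_bounds[of p q] by (auto simp: D_def)

lemma D_nonneg: "0 \<le> D p q"
  using D_ge_1[of p q] by (cases "p = q") (auto simp: D_def)

text \<open>Distances up to 2 are harmless, because any detour has length at least 2. Only a
  midpoint and a leaf of another arm can be further apart, at distance \<open>b t\<close>; this
  happens only in non-central blocks, where detours have length at least
  \<open>1 + min (b t) 2\<close> and \<open>b t \<le> 3\<close> suffices.\<close>

lemma near_triangle:
  assumes "block_of p = t" "block_of q = t" "block_of r = t" "p \<noteq> q" "q \<noteq> r" "p \<noteq> r"
  shows "near p r \<le> near p q + near q r"
  using assms b_gt_1[of t] b_le_3[of t] central_b_le_2[of t]
  by (cases p; cases q; cases r) (auto simp: min_def)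

lemma D_triangle: "D p r \<le> D p q + D q r"
proof (cases "p = q \<or> q = r \<or> p = r")
  case True
  then show ?thesis using D_nonneg[of p q] D_nonneg[of q r] by (auto simp: D_def[of p p] D_def[of r r])
next
  case False
  then show ?thesis
    using near_triangle[of p "block_of p" q r] D_nonneg[of p q] D_nonneg[of q r] D_le_4[of p r] D_le_3[of p r]
    by (auto simp: D_def split: if_splits)
qed

fun valid :: "pt \<Rightarrow> bool" where
  "valid (Hub t) \<longleftrightarrow> True" | "valid (Mid t i) \<longleftrightarrow> i < N t" | "valid (Leaf t i) \<longleftrightarrow> i < N t"

definition S :: "pt set" where "S = Collect valid"

definition light :: "nat \<Rightarrow> pt set" where "light t = insert (Hub t) (Mid t ` {..<N t})"

definition leaves :: "nat \<Rightarrow> pt set" where "leaves t = Leaf t ` {..<N t}"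

definition block :: "nat \<Rightarrow> pt set" where "block t = light t \<union> leaves t"

lemma block_eq: "block t = {p \<in> S. block_of p = t}"
proof -
  have "p \<in> block t \<longleftrightarrow> p \<in> S \<and> block_of p = t" for p
    by (cases p) (auto simp: block_def light_def leaves_def S_def)
  then show ?thesis by auto
qed

lemma finite_block [simp]: "finite (light t)" "finite (leaves t)" "finite (block t)"
  by (auto simp: block_def light_def leaves_def)

lemma sum_light: "sum g (light t) = g (Hub t) + (\<Sum>i<N t. g (Mid t i))"
  by (auto simp: light_def sum.reindex inj_on_def image_iff)

lemma sum_leaves: "sum g (leaves t) = (\<Sum>i<N t. g (Leaf t i))"
  by (auto simp: leaves_def sum.reindex inj_on_def)

lemma sum_block: "sum g (block t) = sum g (light t) + sum g (leaves t)"
  unfolding block_def by (rule sum.union_disjoint) (auto simp: light_def leaves_def)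

section \<open>Balls inside a star\<close>

definition pball :: "pt \<Rightarrow> real \<Rightarrow> pt set" where "pball p r = {q \<in> S. D p q < r}"

lemma pball_mono: "r \<le> r' \<Longrightarrow> pball p r \<subseteq> pball p r'"
  by (auto simp: pball_def)

lemma pball_subset_block: "r \<le> 4 \<Longrightarrow> pball p r \<subseteq> block (block_of p)"
  by (auto simp: pball_def block_eq D_def split: if_splits)

lemma pball_eq_S: "4 < r \<Longrightarrow> pball p r = S"
  using D_le_4 by (auto simp: pball_def intro: le_less_trans)

text \<open>Distinct points are at distance at least 1, so a ball around a midpoint is a singleton
  or reaches the hub. A ball of the second kind has mass at least \<open>scale t\<close>, which
  makes it harmless for light points.\<close>

lemma light_ball:
  assumes y: "y \<in> block t" and p: "p \<in> pball y r" "p \<in> light t"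
  shows "pball y r = {p} \<or> (\<exists>z. z \<in> pball y r \<and> z \<in> insert (Hub t) (leaves t))"
proof (cases "y \<in> insert (Hub t) (leaves t)")
  case True
  moreover have "y \<in> pball y r"
    using y p D_nonneg[of y p] by (auto simp: pball_def block_eq D_def split: if_splits)
  ultimately show ?thesis by blast
next
  case False
  then obtain j where j: "y = Mid t j" "j < N t" using y by (auto simp: block_def light_def)
  show ?thesis
  proof (cases "1 < r")
    case True
    then have "Hub t \<in> pball y r" using j by (auto simp: pball_def D_def S_def)
    then show ?thesis by blast
  next
    case False
    have "z = y" if "z \<in> pball y r" for z
      using that D_ge_1[of y z] False by (auto simp: pball_def)
    then show ?thesis using p by blast
  qed
qed

text \<open>The third alternative is the bad one; in the first the denominator carries the mass of
  all leaves, and in the second the ball sees only one arm. If the dilated ball misses some leaf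
  \<open>j\<close>, then \<open>k * r\<close> is at most the distance to it, and each type of center
  is examined.\<close>

lemma leaf_ball:
  assumes y: "y \<in> block t" and k: "1 \<le> k" and p: "Leaf t i \<in> pball y r"
  shows "leaves t \<subseteq> pball y (k * r) \<or> pball y r \<subseteq> {Leaf t i, Mid t i}
    \<or> k < b t \<and> (central t \<or> y \<noteq> Leaf t i) \<and> pball y r \<subseteq> insert (Leaf t i) (light t)"
proof (cases "leaves t \<subseteq> pball y (k * r)")
  case False
  then obtain z where "z \<in> leaves t" "z \<notin> pball y (k * r)" by blast
  then obtain j where j: "j < N t" "k * r \<le> D y (Leaf t j)"
    by (auto simp: leaves_def pball_def S_def)
  have r0: "0 < r" and i: "i < N t" using p D_nonneg[of y "Leaf t i"] by (auto simp: pball_def S_def)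
  have r: "r \<le> k * r" using k r0 by simp
  have y_blk: "block_of y = t" using y by (simp add: block_eq)
  then have "D y (Leaf t j) \<le> 3" using D_le_3 by simp
  then have sub: "pball y r \<subseteq> block t" using pball_subset_block[of r y] r j y_blk by simp
  have pi: "D y (Leaf t i) < r" using p by (simp add: pball_def)
  have kr: "k < k * r" if "1 < r" using that k by (simp add: field_simps)
  show ?thesis
  proof (cases y)
    \<comment> \<open>The hub is equidistant from all leaves, so it cannot reach leaf
      \<open>i\<close> and miss leaf \<open>j\<close>.\<close>
    case (Hub t')
    then show ?thesis using pi j r y_blk by (auto simp: D_def)
  next
    case (Mid t' m)
    show ?thesis
    proof (cases "m = i")
      case True
      have "j \<noteq> i" using pi j r by auto
      then have "D y (Leaf t j) = b t" "D y (Leaf t i) = 1" using Mid True y_blk by (auto simp: D_def)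
      then have "k < b t" using j pi kr by simp
      moreover have "z \<in> insert (Leaf t i) (light t)" if z: "z \<in> pball y r" for z
      proof (rule ccontr)
        assume z': "z \<notin> insert (Leaf t i) (light t)"
        then obtain l where "z = Leaf t l" "l \<noteq> i" using z sub by (auto simp: block_def leaves_def)
        then have "D y z = b t" using Mid True y_blk by (auto simp: D_def)
        then show False using z j r \<open>D y (Leaf t j) = b t\<close> by (simp add: pball_def)
      qed
      ultimately show ?thesis using Mid by blast
    next
      case False
      \<comment> \<open>From the midpoint of a different arm, a ball that reaches leaf
        \<open>i\<close> already reaches every leaf.\<close>
      then have "b t < r" using pi Mid y_blk by (auto simp: D_def)
      moreover have "D y (Leaf t j) \<le> b t" using Mid y_blk b_gt_1[of t] by (auto simp: D_def)
      ultimately show ?thesis using j r by simp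
    qed
  next
    case (Leaf t' m)
    have t': "t' = t" using Leaf y_blk by simp
    have s: "1 < min (b t) 2" using b_gt_1 by simp
    have Dl: "D y (Leaf t l) = (if l = m then 0 else min (b t) 2)" for l
      using Leaf t' by (simp add: D_def)
    have m: "m = i"
    proof (rule ccontr)
      assume "m \<noteq> i"
      then have "min (b t) 2 < r" using Dl[of i] pi by simp
      moreover have "D y (Leaf t j) \<le> min (b t) 2" using Dl[of j] s by simp
      ultimately show False using j r by linarith
    qed
    have ji: "k * r \<le> min (b t) 2" using Dl[of j] j s r r0 by (cases "j = m") auto
    have only: "pball y r \<subseteq> insert (Leaf t i) (light t)"
    proof
      fix z assume z: "z \<in> pball y r"
      show "z \<in> insert (Leaf t i) (light t)"
      proof (rule ccontr)
        assume z': "z \<notin> insert (Leaf t i) (light t)"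
        then obtain l where "z = Leaf t l" "l \<noteq> i" using z sub by (auto simp: block_def leaves_def)
        then show False using z Dl[of l] m ji r by (simp add: pball_def)
      qed
    qed
    show ?thesis
    proof (cases "central t \<and> 1 < r")
      case True
      then show ?thesis using only kr ji by auto
    next
      \<comment> \<open>If \<open>r \<le> 1\<close> the ball is a singleton. In a non-central block
        the hub and the midpoints of other arms are at distance at least
        \<open>min (b t) 2 \<ge> k * r\<close> from the leaf, so they are missed.\<close>
      case False
      have "z = Leaf t i \<or> z = Mid t i" if z: "z \<in> pball y r" for z
      proof (rule ccontr)
        assume z': "\<not> (z = Leaf t i \<or> z = Mid t i)"
        then have "1 < r" using z D_ge_1[of y z] Leaf m t' by (auto simp: pball_def)
        then have nty: "\<not> central t" using False by simp
        have "z = Hub t \<or> (\<exists>l. z = Mid t l \<and> l \<noteq> i)" using z z' only by (auto simp: light_def)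
        then have "min (b t) 2 \<le> D y z" using nty Leaf m t' by (auto simp: D_def)
        then show False using z ji r by (simp add: pball_def)
      qed
      then show ?thesis by blast
    qed
  qed
qed simp

section \<open>Realisation as a metric measure space on a set of reals\<close>

definition enc :: "pt \<Rightarrow> real" where "enc p = real (to_nat p)"
definition dec :: "real \<Rightarrow> pt" where "dec x = from_nat (nat \<lfloor>x\<rfloor>)"
definition X :: "real set" where "X = enc ` S"
definition \<rho> :: "real \<Rightarrow> real \<Rightarrow> real" where "\<rho> x y = D (dec x) (dec y)"
text \<open>Hub, midpoints and leaves of a block weigh \<open>2 + N t * W t\<close> times the hub
  mass; this normalisation gives block \<open>t\<close> mass \<open>(1/2) ^ t\<close>, so the total
  mass is finite.\<close>

definition scale :: "nat \<Rightarrow> real" where "scale t = (1/2) ^ t / (2 + real (N t) * W t)"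

fun wt :: "pt \<Rightarrow> real" where
  "wt (Hub t) = scale t" | "wt (Mid t i) = scale t / real (N t)" | "wt (Leaf t i) = scale t * W t"

definition \<mu> :: "real measure" where "\<mu> = point_measure X (\<lambda>x. ennreal (wt (dec x)))"

lemma dec_enc [simp]: "dec (enc p) = p"
  by (simp add: dec_def enc_def)

lemma inj_enc: "inj_on enc A"
  by (metis dec_enc inj_onI)

lemma enc_eq_iff [simp]: "enc p = enc q \<longleftrightarrow> p = q"
  by (metis dec_enc)

lemma scale_pos: "0 < scale t"
  unfolding scale_def using W_ge_1[of t] by (intro divide_pos_pos add_pos_nonneg mult_nonneg_nonneg) auto

lemma wt_pos: "0 < wt p"
  using scale_pos N_pos less_le_trans[OF zero_less_one W_ge_1]
  by (cases p) (auto intro!: divide_pos_pos mult_pos_pos)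

lemma sum_wt_light: "sum wt (light t) = 2 * scale t"
  using N_pos[of t] by (simp add: sum_light)

lemma sum_wt_leaves: "sum wt (leaves t) = real (N t) * (scale t * W t)"
  by (simp add: sum_leaves)

lemma sum_wt_block: "sum wt (block t) = (1/2) ^ t"
proof -
  have "0 < 2 + real (N t) * W t" using W_ge_1[of t] by (intro add_pos_nonneg mult_nonneg_nonneg) auto
  moreover have "sum wt (block t) = scale t * (2 + real (N t) * W t)"
    unfolding sum_block sum_wt_light sum_wt_leaves by (simp add: algebra_simps)
  ultimately show ?thesis by (simp add: scale_def)
qed

lemma sets_\<mu> [simp]: "sets \<mu> = Pow X" and space_\<mu> [simp]: "space \<mu> = X"
  by (simp_all add: \<mu>_def sets_point_measure space_point_measure)

lemma borel_measurable_\<mu> [simp]: "f \<in> borel_measurable \<mu>"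
  for f :: "real \<Rightarrow> 'b::topological_space"
  by (auto simp: measurable_def)

lemma enc_image_sets [simp]: "A \<subseteq> S \<Longrightarrow> enc ` A \<in> sets \<mu>"
  by (auto simp: X_def)

lemma emeasure_\<mu>: "A \<subseteq> S \<Longrightarrow> finite A \<Longrightarrow> emeasure \<mu> (enc ` A) = ennreal (sum wt A)"
  unfolding \<mu>_def using wt_pos
  by (subst emeasure_point_measure_finite2)
    (auto simp: X_def sum.reindex[OF inj_enc] sum_ennreal less_imp_le subset_iff)

lemma block_subset: "block t \<subseteq> S" "light t \<subseteq> S" "leaves t \<subseteq> S"
  by (auto simp: block_eq) (auto simp: light_def leaves_def S_def)

lemma X_UN: "X = (\<Union>t. enc ` block t)"
  by (auto simp: X_def block_eq)

lemma disjoint_blocks: "disjoint_family (\<lambda>t. enc ` block t)"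
  by (auto simp: disjoint_family_on_def block_eq)

lemma emeasure_\<mu>_X: "emeasure \<mu> X < \<infinity>"
proof -
  have "emeasure \<mu> X = (\<Sum>t. emeasure \<mu> (enc ` block t))"
    unfolding X_UN by (intro suminf_emeasure[symmetric] disjoint_blocks) (use block_subset(1) in \<open>auto simp: X_def\<close>)
  also have "\<dots> = (\<Sum>t. ennreal ((1/2) ^ t))"
    by (simp add: emeasure_\<mu> block_subset sum_wt_block)
  also have "\<dots> = ennreal (\<Sum>t. (1/2) ^ t)"
    by (rule suminf_ennreal2) auto
  also have "\<dots> < \<infinity>" by simp
  finally show ?thesis .
qed

sublocale finite_measure \<mu>
  using emeasure_\<mu>_X by (intro finite_measureI) simp

sublocale Metric_space X \<rho>
proof
  show "0 \<le> \<rho> x y" "\<rho> x y = \<rho> y x" for x y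
    by (simp_all add: \<rho>_def D_nonneg D_commute)
  show "\<rho> x y = 0 \<longleftrightarrow> x = y" if "x \<in> X" "y \<in> X" for x y
    using that D_ge_1[of "dec x" "dec y"] by (auto simp: \<rho>_def X_def D_def)
  show "\<rho> x z \<le> \<rho> x y + \<rho> y z" if "x \<in> X" "y \<in> X" "z \<in> X" for x y z
    by (simp add: \<rho>_def D_triangle)
qed

lemma mball_enc: "p \<in> S \<Longrightarrow> mball (enc p) r = enc ` pball p r"
  unfolding mball_def by (auto simp: pball_def X_def \<rho>_def)

text \<open>Balls of radius 1 are singletons, so the topology is discrete and measurability is never
  an issue.\<close>

lemma openin_iff: "openin mtopology U \<longleftrightarrow> U \<subseteq> X"
proof
  assume "U \<subseteq> X"
  moreover have "mball x 1 \<subseteq> U" if "x \<in> U" "U \<subseteq> X" for x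
  proof -
    obtain p where p: "x = enc p" "p \<in> S" using \<open>x \<in> U\<close> \<open>U \<subseteq> X\<close> by (auto simp: X_def)
    have "q = p" if "q \<in> pball p 1" for q using that D_ge_1[of p q] by (auto simp: pball_def)
    then show ?thesis using p \<open>x \<in> U\<close> by (auto simp: mball_enc)
  qed
  ultimately show "openin mtopology U"
    unfolding openin_mtopology by (metis zero_less_one)
qed (auto simp: openin_mtopology)

sublocale metric_measure_space X \<rho> \<mu>
proof
  show "X \<noteq> {}" by (auto simp: X_def S_def intro!: exI[of _ "Hub 0"])
  show "mbounded X"
    unfolding mbounded_alt using D_le_4 by (auto simp: \<rho>_def intro!: exI[of _ 4])
  have "countable X" by (simp add: X_def)
  then show "separable_space mtopology"
    unfolding separable_space_def
    by (intro exI[of _ X]) (metis closure_of_topspace order_refl topspace_mtopology)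
  show "space \<mu> = X" by simp
  have "{U. openin mtopology U} = Pow X" by (auto simp: openin_iff)
  then show "sets \<mu> = sigma_sets X {U. openin mtopology U}"
    by (simp only: sets_\<mu>) (rule sigma_algebra.sigma_sets_eq[OF sigma_algebra_Pow, symmetric])
  fix x r assume x: "x \<in> X" and r: "(0::real) < r"
  show "emeasure \<mu> (mball x r) < \<infinity>"
    using emeasure_finite[of "mball x r"] by (simp add: less_top[symmetric])
  obtain p where p: "x = enc p" "p \<in> S" using x by (auto simp: X_def)
  have "0 < emeasure \<mu> (enc ` {p})"
    using p wt_pos[of p] by (subst emeasure_\<mu>) auto
  also have "\<dots> \<le> emeasure \<mu> (mball x r)"
    using p x r by (intro emeasure_mono) (simp_all add: mball_subset_mspace)
  finally show "0 < emeasure \<mu> (mball x r)" .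
qed

section \<open>Upper bounds\<close>

lemma X_cases:
  assumes "x \<in> X"
  obtains p where "p \<in> S" "x = enc p"
  using assms by (auto simp: X_def)

text \<open>The charge of a point bounds its weight times \<open>\<tau> powr q\<close> on the level set of height \<open>\<tau>\<close>, while its
  sum over a block stays comparable to the integral of \<open>\<bar>f\<bar> powr q\<close>.\<close>

fun charge :: "(pt \<Rightarrow> real) \<Rightarrow> real \<Rightarrow> pt \<Rightarrow> real" where
  "charge \<phi> K (Hub t) = \<phi> (Hub t) + sum \<phi> (block t)"
| "charge \<phi> K (Mid t i) = \<phi> (Mid t i) + sum \<phi> (block t) / real (N t)"
| "charge \<phi> K (Leaf t i) = \<phi> (Leaf t i) + \<phi> (Mid t i) + (1 + K) * sum \<phi> (block t) / real (N t)"

text \<open>The bound does not depend on \<open>N t\<close> or \<open>W t\<close>: the points' own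
  terms count once, hub and midpoints together receive the block sum twice, the leaves
  \<open>1 + K\<close> times, and the midpoint terms repeated at the leaves add at most one
  more.\<close>

lemma sum_charge_le:
  assumes "\<And>p. 0 \<le> \<phi> p"
  shows "sum (charge \<phi> K) (block t) \<le> (5 + K) * sum \<phi> (block t)"
proof -
  have "sum (charge \<phi> K) (block t)
    = sum \<phi> (light t) + 2 * sum \<phi> (block t) + sum \<phi> (leaves t) + (\<Sum>i<N t. \<phi> (Mid t i))
      + (1 + K) * sum \<phi> (block t)"
    using N_pos[of t]
    by (simp add: sum_block[of "charge \<phi> K"] sum_light sum_leaves sum.distrib)
  moreover have "(\<Sum>i<N t. \<phi> (Mid t i)) \<le> sum \<phi> (light t)" using assms by (simp add: sum_light)
  moreover have "sum \<phi> (light t) + sum \<phi> (leaves t) = sum \<phi> (block t)" by (simp add: sum_block)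
  moreover have "0 \<le> sum \<phi> (leaves t)" using assms by (simp add: sum_nonneg)
  ultimately show ?thesis by (simp add: algebra_simps)
qed

lemma nn_integral_enc_image:
  assumes A: "A \<subseteq> S" "finite A" and F: "\<And>x. 0 \<le> F x"
  shows "(\<integral>\<^sup>+x\<in>enc ` A. ennreal (F x) \<partial>\<mu>) = ennreal (\<Sum>p\<in>A. wt p * F (enc p))"
proof -
  have "(\<integral>\<^sup>+x\<in>enc ` A. ennreal (F x) \<partial>\<mu>)
      = (\<integral>\<^sup>+x. ennreal (wt (dec x)) * (ennreal (F x) * indicator (enc ` A) x) \<partial>count_space X)"
    unfolding \<mu>_def point_measure_def by (subst nn_integral_density) auto
  also have "\<dots> = (\<Sum>x\<in>enc ` A. ennreal (wt (dec x)) * (ennreal (F x) * indicator (enc ` A) x))"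
    using A by (intro nn_integral_count_space') (auto simp: X_def)
  also have "\<dots> = (\<Sum>p\<in>A. ennreal (wt p * F (enc p)))"
    using A F wt_pos by (subst sum.reindex[OF inj_enc]) (auto intro!: sum.cong simp: ennreal_mult less_imp_le subset_iff)
  also have "\<dots> = ennreal (\<Sum>p\<in>A. wt p * F (enc p))"
    using A F wt_pos by (intro sum_ennreal) (auto simp: less_imp_le subset_iff)
  finally show ?thesis .
qed

lemma measure_enc_image: "A \<subseteq> S \<Longrightarrow> finite A \<Longrightarrow> measure \<mu> (enc ` A) = sum wt A"
  using sum_nonneg[of A wt] wt_pos by (simp add: measure_def emeasure_\<mu> less_imp_le subset_eq)

text \<open>\<open>nn_integral_powr_lower_bound\<close> for finite sets of points, where integrals
  are weighted sums.\<close>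

lemma sum_powr_lower_bound:
  assumes A: "A \<subseteq> S" "finite A" and q: "1 \<le> q" and \<tau>: "0 < \<tau>" and m: "sum wt A \<le> m"
    and big: "\<tau> * m < (\<Sum>p\<in>A. wt p * \<bar>f (enc p)\<bar>)"
  shows "(\<tau> / 2) powr q * m \<le> (\<Sum>p\<in>A. wt p * \<bar>f (enc p)\<bar> powr q)"
proof -
  have w: "0 \<le> wt p" if "p \<in> A" for p using wt_pos[of p] by simp
  then have m0: "0 \<le> m" using m sum_nonneg[of A wt] by auto
  have "ennreal ((\<tau> / 2) powr q * m) \<le> (\<integral>\<^sup>+x\<in>enc ` A. ennreal (\<bar>f x\<bar> powr q) \<partial>\<mu>)"
  proof (rule nn_integral_powr_lower_bound)
    show "emeasure \<mu> (enc ` A) \<le> ennreal m" using A m by (simp add: emeasure_\<mu> ennreal_leI)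
    show "ennreal \<tau> * ennreal m < (\<integral>\<^sup>+x\<in>enc ` A. ennreal \<bar>f x\<bar> \<partial>\<mu>)"
      using A big \<tau> m0 by (simp add: nn_integral_enc_image ennreal_less_iff flip: ennreal_mult)
  qed (use A q \<tau> m0 in \<open>auto simp: X_def\<close>)
  then show ?thesis
    using A w by (simp add: nn_integral_enc_image ennreal_le_iff sum_nonneg)
qed

text \<open>The pointwise core of the upper bounds: each alternative of \<open>light_ball\<close>
  and \<open>leaf_ball\<close> is paid for by one summand of \<open>charge\<close>. In the bad
  alternative \<open>K\<close> enters through the bound on
  \<open>N t * W t powr (1 - q)\<close>.\<close>

lemma charge_lower_bound:
  fixes f :: "real \<Rightarrow> real" and q \<tau> k K r :: real
  defines "\<phi> \<equiv> \<lambda>p. wt p * \<bar>f (enc p)\<bar> powr q"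
  assumes q: "1 \<le> q" and \<tau>: "0 < \<tau>" and k: "1 \<le> k" and K: "0 \<le> K"
    and y: "y \<in> S" and p: "p \<in> pball y r" and r: "r \<le> 4" "block_of p = t"
    and big: "ennreal \<tau> * emeasure \<mu> (mball (enc y) (k * r)) < (\<integral>\<^sup>+x\<in>mball (enc y) r. ennreal \<bar>f x\<bar> \<partial>\<mu>)"
    and bad: "k < b t \<Longrightarrow> central t \<or> y \<noteq> p \<Longrightarrow> real (N t) * W t powr (1 - q) \<le> K"
  shows "(\<tau> / 8) powr q * wt p \<le> charge \<phi> K p"
proof -
  define B where "B = pball y r"
  define m where "m = measure \<mu> (mball (enc y) (k * r))"
  \<comment> \<open>The 8 is a product of three factors 2 lost in the bad case: separating the leaf
    from the light points, the light mass \<open>2 * scale t\<close>, and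
    \<open>sum_powr_lower_bound\<close>.\<close>
  define u where "u = (\<tau> / 8) powr q"
  have u0: "0 \<le> u" by (simp add: u_def)
  have pS: "p \<in> S" using p by (simp add: pball_def)
  have r0: "0 < r" using p D_nonneg[of y p] by (auto simp: pball_def)
  have rk: "r \<le> k * r" using k r0 by simp
  have block_of_y: "block_of y = t" using p r pball_subset_block[of r y] by (auto simp: block_eq)
  then have yt: "y \<in> block t" using y by (simp add: block_eq)
  have B: "B \<subseteq> block t" "B \<subseteq> S" "finite B"
    using pball_subset_block[of r y] r block_of_y finite_subset[OF _ finite_block(3)] by (auto simp: B_def pball_def)
  have wt0: "0 \<le> wt z" if "z \<in> S" for z using wt_pos[of z] by simp
  have \<phi>0: "0 \<le> \<phi> z" if "z \<in> S" for z using wt0[OF that] by (simp add: \<phi>_def)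
  have \<phi>_mono: "sum \<phi> A \<le> sum \<phi> (block t)" if "A \<subseteq> block t" for A
    using that \<phi>0 by (intro sum_mono2[OF finite_block(3)]) (auto simp: block_eq)
  have \<Phi>0: "0 \<le> sum \<phi> (block t)" using \<phi>0 by (intro sum_nonneg) (auto simp: block_eq)
  have sub_m: "sum wt A \<le> m" if "A \<subseteq> pball y (k * r)" "finite A" for A
  proof -
    have "A \<subseteq> S" using that by (auto simp: pball_def)
    then have "sum wt A = measure \<mu> (enc ` A)" using that by (simp add: measure_enc_image)
    also have "\<dots> \<le> m"
      unfolding m_def mball_enc[OF y] using that(1)
      by (intro finite_measure_mono image_mono enc_image_sets) (auto simp: pball_def)
    finally show ?thesis .
  qed
  have B_m: "sum wt B \<le> m" using sub_m[of B] B rk pball_mono[of r "k * r" y] by (simp add: B_def)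
  have m0: "0 \<le> m" by (simp add: m_def)
  have big': "\<tau> * m < (\<Sum>z\<in>B. wt z * \<bar>f (enc z)\<bar>)"
    using big y B \<tau> m0 unfolding emeasure_eq_measure m_def[symmetric]
    by (simp add: mball_enc nn_integral_enc_image ennreal_less_iff flip: ennreal_mult B_def)
  have "(\<tau> / 2) powr q * m \<le> sum \<phi> B"
    unfolding \<phi>_def using B B_m q \<tau> big' by (intro sum_powr_lower_bound)
  moreover have "u * m \<le> (\<tau> / 2) powr q * m"
    unfolding u_def using \<tau> q m0 by (intro mult_right_mono powr_mono2) auto
  ultimately have um: "u * m \<le> sum \<phi> B" by simp
  then have um': "u * m \<le> sum \<phi> (block t)" using \<phi>_mono[OF B(1)] by simp
  have "u * wt p \<le> charge \<phi> K p"
  proof (cases "p \<in> light t")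
    case True
    from light_ball[OF yt p True] show ?thesis
    proof
      assume "pball y r = {p}"
      then have "u * wt p \<le> \<phi> p"
        using um u0 B_m mult_left_mono[of "wt p" m u] by (simp add: B_def)
      also have "\<phi> p \<le> charge \<phi> K p"
        using True \<Phi>0 by (cases p) (auto simp: light_def)
      finally show ?thesis .
    next
      assume "\<exists>z. z \<in> pball y r \<and> z \<in> insert (Hub t) (leaves t)"
      then obtain z where z: "z \<in> B" "z \<in> insert (Hub t) (leaves t)" by (auto simp: B_def)
      have "scale t \<le> wt z" using z(2) scale_pos[of t] W_ge_1[of t] by (auto simp: leaves_def)
      also have "wt z \<le> sum wt B" using z B wt0 by (intro member_le_sum) auto
      finally have "u * scale t \<le> u * m" using B_m u0 by (intro mult_left_mono) auto
      then have *: "u * scale t \<le> sum \<phi> (block t)" using um' by simp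
      then have "u * scale t / real (N t) \<le> sum \<phi> (block t) / real (N t)" by (rule divide_right_mono) simp
      then show ?thesis using True * \<phi>0[OF pS] by (auto simp: light_def)
    qed
  next
    case False
    then obtain i where i: "p = Leaf t i" "i < N t"
      using pS r(2) by (cases p) (auto simp: S_def light_def)
    have N0: "0 < real (N t)" using N_pos by simp
    have MS: "Mid t i \<in> S" using i by (simp add: S_def)
    have K\<Phi>: "0 \<le> K * sum \<phi> (block t) / real (N t)" using K \<Phi>0 N0 by simp
    have \<Phi>N: "0 \<le> sum \<phi> (block t) / real (N t)" using \<Phi>0 N0 by simp
    have split: "charge \<phi> K p = \<phi> p + \<phi> (Mid t i) + sum \<phi> (block t) / real (N t)
        + K * sum \<phi> (block t) / real (N t)"
      by (simp add: i ring_distribs add_divide_distrib)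
    consider "leaves t \<subseteq> pball y (k * r)" | "pball y r \<subseteq> {Leaf t i, Mid t i}"
      | "k < b t" "central t \<or> y \<noteq> Leaf t i" "pball y r \<subseteq> insert (Leaf t i) (light t)"
      using leaf_ball[OF yt k] p i by blast
    then show ?thesis
    proof cases
      case 1
      then have "u * (real (N t) * wt p) \<le> u * m"
        using sub_m[of "leaves t"] u0 i by (intro mult_left_mono) (auto simp: sum_wt_leaves)
      then have "u * wt p \<le> sum \<phi> (block t) / real (N t)"
        using um' N0 by (simp add: field_simps)
      then show ?thesis unfolding split using \<phi>0[OF pS] \<phi>0[OF MS] K\<Phi> by simp
    next
      case 2
      have "sum \<phi> B \<le> sum \<phi> {Leaf t i, Mid t i}"
        using 2 \<phi>0[OF pS] \<phi>0[OF MS] i by (intro sum_mono2) (auto simp: B_def)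
      moreover have "u * wt p \<le> u * m"
        using sub_m[of "{p}"] p rk pball_mono[of r "k * r" y] u0 by (intro mult_left_mono) auto
      ultimately show ?thesis unfolding split using um \<Phi>N K\<Phi> i by simp
    next
      case 3
      have N_le: "real (N t) * W t powr (1 - q) \<le> K" using bad 3 i by simp
      have W0: "0 < W t" using W_ge_1[of t] by simp
      have wp: "wt p = scale t * W t" using i by simp
      have pm: "wt p \<le> m"
        using sub_m[of "{p}"] p rk pball_mono[of r "k * r" y] by auto
      have "(\<Sum>z\<in>B. wt z * \<bar>f (enc z)\<bar>) \<le> (\<Sum>z\<in>insert p (light t). wt z * \<bar>f (enc z)\<bar>)"
        using 3 i pS block_subset(2)[of t] by (intro sum_mono2 mult_nonneg_nonneg wt0) (auto simp: B_def)
      also have "\<dots> = wt p * \<bar>f (enc p)\<bar> + (\<Sum>z\<in>light t. wt z * \<bar>f (enc z)\<bar>)"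
        using False by simp
      finally have "\<tau> * wt p < wt p * \<bar>f (enc p)\<bar> + (\<Sum>z\<in>light t. wt z * \<bar>f (enc z)\<bar>)"
        using big' pm \<tau> by (smt (verit) mult_left_mono)
      \<comment> \<open>Either the leaf itself or the light part of the ball accounts for half of
        the large average.\<close>
      then consider "\<tau> / 2 * wt p < wt p * \<bar>f (enc p)\<bar>"
        | "\<tau> / 2 * wt p < (\<Sum>z\<in>light t. wt z * \<bar>f (enc z)\<bar>)" by argo
      then show ?thesis
      proof cases
        case 1
        then have "\<tau> / 8 \<le> \<bar>f (enc p)\<bar>" using wt_pos[of p] \<tau> by (simp add: mult.commute)
        then have "u * wt p \<le> \<phi> p"
          unfolding u_def \<phi>_def mult.commute[of _ "wt p"]
          using wt0[OF pS] \<tau> q by (intro mult_left_mono powr_mono2) auto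
        then show ?thesis unfolding split using \<phi>0[OF MS] \<Phi>N K\<Phi> by simp
      next
        case 2
        \<comment> \<open>The light points are lighter than the leaf by a factor of order
          \<open>W t\<close>, so their average exceeds \<open>\<tau> * W t / 4\<close>. Raising to
          the power \<open>q\<close> gains \<open>W t powr q\<close>, of which only one factor
          \<open>W t\<close> is spent on the leaf weight.\<close>
        have "\<tau> * W t / 4 * (2 * scale t) < (\<Sum>z\<in>light t. wt z * \<bar>f (enc z)\<bar>)"
          using 2 by (simp add: wp algebra_simps)
        then have "(\<tau> * W t / 4 / 2) powr q * (2 * scale t) \<le> sum \<phi> (light t)"
          unfolding \<phi>_def using \<tau> W0 q block_subset by (intro sum_powr_lower_bound) (auto simp: sum_wt_light)
        also have "\<dots> \<le> sum \<phi> (block t)" by (rule \<phi>_mono) (simp add: block_def)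
        also have "(\<tau> * W t / 4 / 2) powr q = u * W t powr q"
          using \<tau> W0 by (simp add: u_def powr_mult powr_divide)
        finally have "2 * (u * W t powr q * scale t) \<le> sum \<phi> (block t)" by (simp add: mult_ac)
        moreover have "0 \<le> u * W t powr q * scale t" using u0 scale_pos[of t] by simp
        ultimately have *: "u * W t powr q * scale t \<le> sum \<phi> (block t)" by linarith
        have "u * wt p = u * W t powr q * scale t * W t powr (1 - q)"
          using W0 by (simp add: wp powr_diff)
        also have "\<dots> \<le> sum \<phi> (block t) * (K / real (N t))"
          using * N_le N0 \<Phi>0 by (intro mult_mono) (auto simp: field_simps)
        finally show ?thesis unfolding split using \<phi>0[OF pS] \<phi>0[OF MS] \<Phi>N by (simp add: mult.commute)
      qed
    qed
  qed
  then show ?thesis by (simp add: u_def)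
qed

text \<open>Summing the charges over the level set bounds its mass block by block, with a constant
  that is the same for all blocks.\<close>

lemma weak_type_ball_dominated:
  assumes T: "ball_dominated cen k T" and k: "1 \<le> k" and q: "1 \<le> q" and K: "0 \<le> K"
    and bad: "\<And>t. k < b t \<Longrightarrow> cen \<longrightarrow> central t \<Longrightarrow> real (N t) * W t powr (1 - q) \<le> K"
  shows "weak_type \<mu> (ennreal q) T"
proof (rule weak_typeI[OF q])
  show "0 \<le> (5 + K) * 8 powr q" using K by simp
  fix f :: "real \<Rightarrow> real" and \<tau> :: real assume \<tau>: "0 < \<tau>"
  define E where "E = {x \<in> X. ennreal \<tau> < T f x}"
  define u where "u = (\<tau> / 8) powr q"
  \<comment> \<open>As a measure, the integral of \<open>\<bar>f\<bar> powr q\<close> is countably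
    additive over the blocks.\<close>
  define \<Phi> where "\<Phi> = density \<mu> (\<lambda>x. ennreal (\<bar>f x\<bar> powr q))"
  define \<phi> where "\<phi> p = wt p * \<bar>f (enc p)\<bar> powr q" for p
  have \<Phi>: "emeasure \<Phi> A = (\<integral>\<^sup>+x\<in>A. ennreal (\<bar>f x\<bar> powr q) \<partial>\<mu>)" if "A \<subseteq> X" for A
    unfolding \<Phi>_def using that by (intro emeasure_density) auto
  have \<Phi>X: "emeasure \<Phi> X = (\<integral>\<^sup>+x. ennreal (\<bar>f x\<bar> powr q) \<partial>\<mu>)"
    unfolding \<Phi>[OF order_refl] by (rule nn_integral_cong) simp
  have u_eq: "\<tau> powr q = 8 powr q * u" using \<tau> by (simp add: u_def powr_divide)
  have "ennreal u * emeasure \<mu> E \<le> ennreal (5 + K) * emeasure \<Phi> X"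
  proof (cases "\<exists>y\<in>X. \<exists>r>4. ennreal \<tau> * emeasure \<mu> (mball y (k * r)) < (\<integral>\<^sup>+x\<in>mball y r. ennreal \<bar>f x\<bar> \<partial>\<mu>)")
    \<comment> \<open>A ball of radius above 4 is all of \<open>X\<close>, as is its dilation. One
      large global average already pays for the whole space, hence for \<open>E\<close>.\<close>
    case True
    then obtain y r where yr: "y \<in> X" "4 < r"
      "ennreal \<tau> * emeasure \<mu> (mball y (k * r)) < (\<integral>\<^sup>+x\<in>mball y r. ennreal \<bar>f x\<bar> \<partial>\<mu>)" by blast
    then obtain z where z: "z \<in> S" "y = enc z" using X_cases by blast
    have "4 < k * r" using k yr by (smt (verit) mult_le_cancel_right1)
    then have X: "mball y r = X" "mball y (k * r) = X"
      using yr(2) z by (simp_all add: mball_enc pball_eq_S X_def[symmetric])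
    have "ennreal ((\<tau> / 2) powr q * measure \<mu> X) \<le> (\<integral>\<^sup>+x\<in>X. ennreal (\<bar>f x\<bar> powr q) \<partial>\<mu>)"
      using yr \<tau> q by (intro nn_integral_powr_lower_bound) (auto simp: X emeasure_eq_measure)
    then have 1: "ennreal ((\<tau> / 2) powr q * measure \<mu> X) \<le> emeasure \<Phi> X" by (simp add: \<Phi>)
    have "ennreal u * emeasure \<mu> E \<le> ennreal u * emeasure \<mu> X"
      by (intro mult_left_mono emeasure_mono) (auto simp: E_def)
    also have "\<dots> = ennreal (u * measure \<mu> X)" by (simp add: emeasure_eq_measure u_def ennreal_mult)
    also have "\<dots> \<le> ennreal ((\<tau> / 2) powr q * measure \<mu> X)"
      unfolding u_def using \<tau> q by (intro ennreal_leI mult_right_mono powr_mono2) auto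
    also have "\<dots> \<le> 1 * emeasure \<Phi> X" using 1 by simp
    also have "\<dots> \<le> ennreal (5 + K) * emeasure \<Phi> X"
      using K ennreal_leI[of 1 "5 + K"] by (intro mult_right_mono) simp_all
    finally show ?thesis .
  next
    case False
    have charge: "u * wt p \<le> charge \<phi> K p" if p: "p \<in> S" "enc p \<in> E" for p
    proof -
      have ep: "enc p \<in> X" "ennreal \<tau> < T f (enc p)" using p by (auto simp: E_def)
      obtain y r where yr: "y \<in> X" "0 < r" "enc p \<in> mball y r" "cen \<Longrightarrow> y = enc p"
        "ennreal \<tau> * emeasure \<mu> (mball y (k * r)) < (\<integral>\<^sup>+x\<in>mball y r. ennreal \<bar>f x\<bar> \<partial>\<mu>)"
        using ball_dominatedD[OF T ep] by metis
      then obtain z where z: "y = enc z" "z \<in> S" by (auto simp: X_def)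
      have r4: "r \<le> 4" using False yr by force
      show ?thesis
        unfolding u_def \<phi>_def
      proof (rule charge_lower_bound[OF q \<tau> k K z(2) _ r4 refl])
        show "p \<in> pball z r" using yr z by (auto simp: mball_enc)
        show "ennreal \<tau> * emeasure \<mu> (mball (enc z) (k * r)) < (\<integral>\<^sup>+x\<in>mball (enc z) r. ennreal \<bar>f x\<bar> \<partial>\<mu>)"
          using yr z by simp
        \<comment> \<open>For a centered operator \<open>z = p\<close>, so the bad case forces the
          block to be central.\<close>
        show "real (N (block_of p)) * W (block_of p) powr (1 - q) \<le> K" if "k < b (block_of p)" "central (block_of p) \<or> z \<noteq> p"
          using that yr z by (intro bad) auto
      qed
    qed
    have \<phi>0: "0 \<le> \<phi> p" for p using wt_pos[of p] by (simp add: \<phi>_def)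
    have block: "ennreal u * emeasure \<mu> (E \<inter> enc ` block t) \<le> ennreal (5 + K) * emeasure \<Phi> (enc ` block t)" for t
    proof -
      let ?A = "{p \<in> block t. enc p \<in> E}"
      have "E \<inter> enc ` block t = enc ` ?A" by auto
      moreover have A: "?A \<subseteq> S" using block_subset by auto
      ultimately have "ennreal u * emeasure \<mu> (E \<inter> enc ` block t) = ennreal (\<Sum>p\<in>?A. u * wt p)"
        using wt_pos by (simp add: emeasure_\<mu> u_def sum_nonneg less_imp_le flip: ennreal_mult sum_distrib_left)
      also have "\<dots> \<le> ennreal (sum (charge \<phi> K) ?A)"
        using charge A by (intro ennreal_leI sum_mono) auto
      also have "\<dots> \<le> ennreal (sum (charge \<phi> K) (block t))"
      proof (intro ennreal_leI sum_mono2)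
        show "0 \<le> charge \<phi> K p" for p
          using \<phi>0 K by (cases p) (simp_all add: sum_nonneg)
      qed auto
      also have "\<dots> \<le> ennreal ((5 + K) * sum \<phi> (block t))"
        by (intro ennreal_leI sum_charge_le \<phi>0)
      also have "\<dots> = ennreal (5 + K) * emeasure \<Phi> (enc ` block t)"
        using K \<phi>0 block_subset
        by (subst \<Phi>) (auto simp: X_def nn_integral_enc_image ennreal_mult' sum_nonneg simp flip: \<phi>_def)
      finally show ?thesis .
    qed
    have "emeasure \<mu> E = (\<Sum>t. emeasure \<mu> (E \<inter> enc ` block t))"
    proof -
      have "E = (\<Union>t. E \<inter> enc ` block t)" using X_UN by (auto simp: E_def)
      moreover have "disjoint_family (\<lambda>t. E \<inter> enc ` block t)"
        using disjoint_blocks by (auto simp: disjoint_family_on_def)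
      moreover have "range (\<lambda>t. E \<inter> enc ` block t) \<subseteq> sets \<mu>" by (auto simp: E_def)
      ultimately show ?thesis by (metis suminf_emeasure)
    qed
    then have "ennreal u * emeasure \<mu> E = (\<Sum>t. ennreal u * emeasure \<mu> (E \<inter> enc ` block t))" by simp
    also have "\<dots> \<le> (\<Sum>t. ennreal (5 + K) * emeasure \<Phi> (enc ` block t))"
      by (intro suminf_le block) auto
    also have "\<dots> = ennreal (5 + K) * (\<Sum>t. emeasure \<Phi> (enc ` block t))" by simp
    also have "(\<Sum>t. emeasure \<Phi> (enc ` block t)) = emeasure \<Phi> X"
      unfolding X_UN using block_subset(1)
      by (intro suminf_emeasure disjoint_blocks) (auto simp: \<Phi>_def X_def)
    finally show ?thesis .
  qed
  then have "ennreal (8 powr q) * (ennreal u * emeasure \<mu> E) \<le> ennreal (8 powr q) * (ennreal (5 + K) * emeasure \<Phi> X)"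
    by (rule mult_left_mono) simp
  then show "ennreal (\<tau> powr q) * emeasure \<mu> {x \<in> space \<mu>. ennreal \<tau> < T f x}
      \<le> ennreal ((5 + K) * 8 powr q) * (\<integral>\<^sup>+x. ennreal (\<bar>f x\<bar> powr q) \<partial>\<mu>)"
    using K by (simp add: u_eq E_def \<Phi>X u_def ennreal_mult ac_simps)
qed

lemma weak_type_infinity:
  assumes "ball_dominated cen k T" "1 \<le> k"
  shows "weak_type \<mu> \<infinity> T"
  using ball_dominated_le_bound[OF assms] by (intro weak_type_infinityI) auto

section \<open>Lower bounds\<close>

text \<open>The numerator is the hub mass \<open>scale t\<close>; the denominator is at most the
  mass of one leaf and all light points, \<open>scale t * (2 + W t)\<close>.\<close>

lemma hub_average:
  assumes y: "y \<in> S" and i: "i < N t" and r: "Hub t \<in> pball y r"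
    and r': "pball y r' \<subseteq> insert (Leaf t i) (light t)"
  shows "ennreal (1 / (2 + W t)) \<le>
    (\<integral>\<^sup>+z\<in>mball (enc y) r. ennreal \<bar>indicator {enc (Hub t)} z\<bar> \<partial>\<mu>) / emeasure \<mu> (mball (enc y) r')"
proof -
  have hub: "enc ` {Hub t} \<subseteq> X" by (auto simp: X_def S_def)
  have "(\<integral>\<^sup>+z\<in>mball (enc y) r. ennreal \<bar>indicator {enc (Hub t)} z\<bar> \<partial>\<mu>) = (\<integral>\<^sup>+z. indicator (enc ` {Hub t}) z \<partial>\<mu>)"
    using r y by (intro nn_integral_cong) (auto simp: mball_enc indicator_def)
  also have "\<dots> = ennreal (scale t)"
    using hub by (subst nn_integral_indicator) (auto simp: emeasure_\<mu> S_def simp del: image_insert)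
  finally have I: "(\<integral>\<^sup>+z\<in>mball (enc y) r. ennreal \<bar>indicator {enc (Hub t)} z\<bar> \<partial>\<mu>) = ennreal (scale t)" .
  have A: "insert (Leaf t i) (light t) \<subseteq> S" using i block_subset(2)[of t] by (auto simp: S_def)
  have "emeasure \<mu> (mball (enc y) r') \<le> emeasure \<mu> (enc ` insert (Leaf t i) (light t))"
    unfolding mball_enc[OF y] using r' A by (intro emeasure_mono image_mono enc_image_sets)
  also have "\<dots> = ennreal (scale t * (2 + W t))"
  proof -
    have "Leaf t i \<notin> light t" by (auto simp: light_def)
    then show ?thesis using A by (simp add: emeasure_\<mu> sum_wt_light algebra_simps del: image_insert)
  qed
  finally have m: "emeasure \<mu> (mball (enc y) r') \<le> ennreal (scale t * (2 + W t))" .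
  have "ennreal (1 / (2 + W t)) \<le> ennreal (scale t) / emeasure \<mu> (mball (enc y) r')"
  proof (cases "measure \<mu> (mball (enc y) r') = 0")
    \<comment> \<open>The sign of \<open>r'\<close> is not prescribed. Over a null ball the quotient
      is infinite, since its numerator is positive.\<close>
    case True
    then show ?thesis using scale_pos[of t] by (simp add: emeasure_eq_measure ennreal_zero_divide top_unique)
  next
    case False
    then have m0: "0 < measure \<mu> (mball (enc y) r')" by (simp add: zero_less_measure_iff)
    have "measure \<mu> (mball (enc y) r') \<le> scale t * (2 + W t)"
      using m scale_pos[of t] W_ge_1[of t] by (simp add: emeasure_eq_measure ennreal_le_iff)
    then have "scale t / (scale t * (2 + W t)) \<le> scale t / measure \<mu> (mball (enc y) r')"
      using m0 scale_pos[of t] W_ge_1[of t] by (intro divide_left_mono) auto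
    then show ?thesis
      using m0 scale_pos[of t] by (simp add: emeasure_eq_measure divide_ennreal ennreal_leI)
  qed
  then show ?thesis unfolding I .
qed

text \<open>The radius \<open>b t / k\<close> exceeds 1, the distance to the hub, because
  \<open>k < b t\<close>; its \<open>k\<close>-dilation has radius exactly
  \<open>b t\<close>.\<close>

lemma Hub_in_pball:
  assumes k: "1 \<le> k" "k < b t"
  shows "Hub t \<in> pball (Mid t i) (b t / k)" "central t \<Longrightarrow> Hub t \<in> pball (Leaf t i) (b t / k)"
  using k by (auto simp: pball_def S_def D_def)

text \<open>Balls are open, so leaves at distance exactly \<open>b t\<close> are missed. From a leaf
  the other leaves are at distance \<open>min (b t) 2\<close>, which is \<open>b t\<close> in
  central blocks.\<close>

lemma pball_b_subset:
  shows "pball (Mid t i) (b t) \<subseteq> insert (Leaf t i) (light t)"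
    "central t \<Longrightarrow> pball (Leaf t i) (b t) \<subseteq> insert (Leaf t i) (light t)"
proof -
  have "pball p (b t) \<subseteq> block t" if "block_of p = t" for p
    using pball_subset_block[of "b t" p] b_le_3[of t] that by auto
  then have sub: "pball (Mid t i) (b t) \<subseteq> block t" "pball (Leaf t i) (b t) \<subseteq> block t" by simp_all
  have "Leaf t j \<notin> pball (Mid t i) (b t) \<and> (central t \<longrightarrow> Leaf t j \<notin> pball (Leaf t i) (b t))" if "j \<noteq> i" for j
    using that central_b_le_2[of t] by (auto simp: pball_def D_def)
  then show "pball (Mid t i) (b t) \<subseteq> insert (Leaf t i) (light t)"
    "central t \<Longrightarrow> pball (Leaf t i) (b t) \<subseteq> insert (Leaf t i) (light t)"
    using sub unfolding block_def leaves_def by blast+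
qed

lemma maximal_c_hub:
  assumes "1 \<le> k" "k < b t" "central t" "i < N t"
  shows "ennreal (1 / (2 + W t)) \<le> maximal_c k (indicator {enc (Hub t)}) (enc (Leaf t i))"
  using hub_average[of "Leaf t i" i t "b t / k" "b t"] le_maximal_c[where r = "b t / k" and x = "enc (Leaf t i)" and k = k and f = "indicator {enc (Hub t)}"]
    assms Hub_in_pball pball_b_subset by (auto simp: S_def)

lemma maximal_hub:
  assumes "1 \<le> k" "k < b t" "i < N t"
  shows "ennreal (1 / (2 + W t)) \<le> maximal k (indicator {enc (Hub t)}) (enc (Leaf t i))"
proof -
  have y: "Mid t i \<in> S" using assms by (simp add: S_def)
  have "enc (Leaf t i) \<in> mball (enc (Mid t i)) (b t / k)"
    using assms y by (auto simp: mball_enc pball_def S_def D_def)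
  then show ?thesis
    using hub_average[of "Mid t i" i t "b t / k" "b t"] assms y Hub_in_pball pball_b_subset
      le_maximal[of "enc (Mid t i)" "b t / k" "enc (Leaf t i)" "indicator {enc (Hub t)}" k]
    by (auto simp: X_def)
qed

text \<open>On the hub indicator the level set contains all leaves, of mass
  \<open>N t * scale t * W t\<close>, while the norm is \<open>scale t powr (1 / q)\<close>. The
  factor \<open>scale t\<close> cancels, so \<open>C\<close> serves all blocks at once.\<close>

lemma weak_type_hub_bound:
  assumes T: "weak_type \<mu> (ennreal q) T" and q: "1 \<le> q"
  obtains C where "\<And>t. (\<And>i. i < N t \<Longrightarrow> ennreal (1 / (2 + W t)) \<le> T (indicator {enc (Hub t)}) (enc (Leaf t i))) \<Longrightarrow>
    real (N t) powr (1 / q) * W t powr (1 / q - 1) \<le> C"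
proof -
  obtain C' where C': "C' < \<infinity>"
    "\<And>f. f \<in> Lp \<mu> (ennreal q) \<Longrightarrow> weak_Lp_norm \<mu> (ennreal q) (T f) \<le> C' * Lp_norm \<mu> (ennreal q) (\<lambda>x. ennreal \<bar>f x\<bar>)"
    using T unfolding weak_type_def by blast
  then obtain c where c: "C' = ennreal c" "0 \<le> c" by (cases C') auto
  show thesis
  proof
    fix t assume leaf: "\<And>i. i < N t \<Longrightarrow> ennreal (1 / (2 + W t)) \<le> T (indicator {enc (Hub t)}) (enc (Leaf t i))"
    define f :: "real \<Rightarrow> real" where "f = indicator {enc (Hub t)}"
    \<comment> \<open>Level sets are strict, so the height lies strictly below
      \<open>1 / (2 + W t)\<close>; this holds because \<open>W t \<ge> 1\<close>.\<close>
    define \<tau> where "\<tau> = 1 / (4 * W t)"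
    define E where "E = {x \<in> X. ennreal \<tau> < T f x}"
    have W0: "0 < W t" using W_ge_1[of t] by simp
    have \<tau>0: "0 < \<tau>" using W0 by (simp add: \<tau>_def)
    have "(\<integral>\<^sup>+x. ennpowr (ennreal \<bar>f x\<bar>) q \<partial>\<mu>) = (\<integral>\<^sup>+x. indicator (enc ` {Hub t}) x \<partial>\<mu>)"
      using q by (intro nn_integral_cong) (auto simp: f_def indicator_def)
    also have "\<dots> = ennreal (scale t)"
      by (subst nn_integral_indicator) (auto simp: emeasure_\<mu> S_def X_def simp del: image_insert)
    finally have norm: "Lp_norm \<mu> (ennreal q) (\<lambda>x. ennreal \<bar>f x\<bar>) = ennreal (scale t powr (1 / q))"
      using q scale_pos[of t] by (simp add: Lp_norm_def less_imp_le)
    then have f: "f \<in> Lp \<mu> (ennreal q)" by (simp add: Lp_def)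
    have "\<tau> < 1 / (2 + W t)"
      unfolding \<tau>_def using W_ge_1[of t] by (intro divide_strict_left_mono) auto
    then have "ennreal \<tau> < ennreal (1 / (2 + W t))" using W0 by (intro ennreal_lessI) auto
    then have "enc ` leaves t \<subseteq> E"
      using leaf block_subset(3)[of t] unfolding E_def f_def[symmetric]
      by (auto simp: leaves_def X_def intro: less_le_trans)
    then have "measure \<mu> (enc ` leaves t) \<le> measure \<mu> E"
      by (intro finite_measure_mono) (auto simp: E_def)
    then have mE: "real (N t) * (scale t * W t) \<le> measure \<mu> E"
      using block_subset(3)[of t] by (simp add: measure_enc_image sum_wt_leaves)
    have "ennreal \<tau> * ennpowr (emeasure \<mu> E) (1 / q) \<le> weak_Lp_norm \<mu> (ennreal q) (T f)"
      unfolding weak_Lp_norm_def E_def using q \<tau>0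
      by simp (rule SUP_upper2[of \<tau>], auto)
    also have "\<dots> \<le> ennreal (c * scale t powr (1 / q))"
      using C'(2)[OF f] c by (simp add: norm ennreal_mult')
    finally have "\<tau> * measure \<mu> E powr (1 / q) \<le> c * scale t powr (1 / q)"
      using \<tau>0 c by (simp add: emeasure_eq_measure ennreal_le_iff flip: ennreal_mult)
    moreover have "(real (N t) * (scale t * W t)) powr (1 / q) \<le> measure \<mu> E powr (1 / q)"
      using mE q W0 scale_pos[of t] by (intro powr_mono2) auto
    ultimately have "\<tau> * (real (N t) * (scale t * W t)) powr (1 / q) \<le> c * scale t powr (1 / q)"
      using \<tau>0 by (meson less_imp_le mult_left_mono order_trans)
    then have "(\<tau> * real (N t) powr (1 / q) * W t powr (1 / q)) * scale t powr (1 / q) \<le> c * scale t powr (1 / q)"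
      using W0 scale_pos[of t] by (simp add: powr_mult mult_ac)
    then have "\<tau> * real (N t) powr (1 / q) * W t powr (1 / q) \<le> c"
      using scale_pos[of t] by simp
    then show "real (N t) powr (1 / q) * W t powr (1 / q - 1) \<le> 4 * c"
      using W0 by (simp add: \<tau>_def powr_diff field_simps)
  qed
qed

end

text \<open>The size of \<open>N t\<close> makes the test constant comparable to
  \<open>W t powr (P t / q - 1)\<close>, and \<open>W t\<close> is so large that
  \<open>W t powr (d t / P t) = Suc t\<close> is unbounded even if the gaps \<open>d t\<close> tend
  to 0.\<close>

locale growing_star_blocks = star_blocks N W b central
  for N W b central +
  fixes P d :: "nat \<Rightarrow> real"
  assumes P_gt_1: "1 < P t" and d_pos: "0 < d t"
    and W_eq: "W t = real (Suc t) powr (P t / d t)"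
    and N_lower: "W t powr (P t - 1) \<le> real (N t)"
    and N_upper: "real (N t) \<le> 2 * W t powr (P t - 1)"
begin

text \<open>Blocks with \<open>P t \<le> q\<close> satisfy
  \<open>N t * W t powr (1 - q) \<le> 2 * W t powr (P t - q) \<le> 2\<close>; the finitely many
  others are absorbed into the constant.\<close>

lemma weak_type_if_finite:
  assumes T: "ball_dominated cen k T" and k: "1 \<le> k" and q: "1 \<le> q"
    and fin: "finite {t. k < b t \<and> (cen \<longrightarrow> central t) \<and> q < P t}"
  shows "weak_type \<mu> (ennreal q) T"
proof -
  let ?A = "{t. k < b t \<and> (cen \<longrightarrow> central t) \<and> q < P t}"
  let ?g = "\<lambda>t. real (N t) * W t powr (1 - q)"
  have g0: "0 \<le> ?g t" for t by simp
  have sum0: "0 \<le> sum ?g ?A" by (intro sum_nonneg g0)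
  show ?thesis
  proof (rule weak_type_ball_dominated[OF T k q])
    show "0 \<le> 2 + sum ?g ?A" using sum0 by simp
    fix t assume t: "k < b t" "cen \<longrightarrow> central t"
    show "?g t \<le> 2 + sum ?g ?A"
    proof (cases "q < P t")
      case True
      then have "?g t \<le> sum ?g ?A" using t fin g0 by (intro member_le_sum) auto
      then show ?thesis by simp
    next
      case False
      have "?g t \<le> 2 * W t powr (P t - 1) * W t powr (1 - q)"
        by (intro mult_right_mono N_upper) simp
      also have "\<dots> = 2 * W t powr (P t - q)" by (simp flip: powr_add)
      also have "\<dots> \<le> 2 * W t powr 0" using False W_ge_1[of t] by (intro mult_left_mono powr_mono) auto
      also have "\<dots> = 2" using W_ge_1[of t] by simp
      finally show ?thesis using sum0 by simp
    qed
  qed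
qed

text \<open>A gap \<open>P t - q \<ge> d t\<close> makes the test constant at least
  \<open>Suc t\<close>, and this occurs for arbitrarily large \<open>t\<close>.\<close>

lemma not_weak_type_if_infinite:
  assumes q: "1 \<le> q"
    and inf: "\<And>n. \<exists>t\<ge>n. q + d t \<le> P t \<and>
      (\<forall>i<N t. ennreal (1 / (2 + W t)) \<le> T (indicator {enc (Hub t)}) (enc (Leaf t i)))"
  shows "\<not> weak_type \<mu> (ennreal q) T"
proof
  assume "weak_type \<mu> (ennreal q) T"
  then obtain C where C: "\<And>t. (\<And>i. i < N t \<Longrightarrow> ennreal (1 / (2 + W t)) \<le> T (indicator {enc (Hub t)}) (enc (Leaf t i))) \<Longrightarrow>
    real (N t) powr (1 / q) * W t powr (1 / q - 1) \<le> C"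
    using weak_type_hub_bound q by metis
  obtain n where n: "C < real n" using reals_Archimedean2 by blast
  obtain t where t: "n \<le> t" "q + d t \<le> P t"
    "\<And>i. i < N t \<Longrightarrow> ennreal (1 / (2 + W t)) \<le> T (indicator {enc (Hub t)}) (enc (Leaf t i))"
    using inf by blast
  have W0: "1 \<le> W t" by (rule W_ge_1)
  have P0: "0 < P t" using P_gt_1[of t] by simp
  have qP: "q \<le> P t" using t d_pos[of t] by simp
  have "d t / P t \<le> d t / q" using qP q d_pos[of t] by (intro divide_left_mono) auto
  also have "\<dots> \<le> (P t - q) / q" using t q by (intro divide_right_mono) auto
  also have "\<dots> = P t / q - 1" using q by (simp add: diff_divide_distrib)
  finally have exponent: "d t / P t \<le> P t / q - 1" .
  have "real (Suc t) = W t powr (d t / P t)"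
    using P0 d_pos[of t] by (simp add: W_eq powr_powr)
  also have "\<dots> \<le> W t powr (P t / q - 1)" using exponent W0 by (intro powr_mono)
  also have "\<dots> = (W t powr (P t - 1)) powr (1 / q) * W t powr (1 / q - 1)"
    by (simp add: powr_powr diff_divide_distrib flip: powr_add)
  also have "\<dots> \<le> real (N t) powr (1 / q) * W t powr (1 / q - 1)"
    using q by (intro mult_right_mono powr_mono2 N_lower) auto
  also have "\<dots> \<le> C" by (rule C) (rule t(3))
  finally show False using n t by simp
qed

end

section \<open>Combining centered and non-centered blocks\<close>

theorem theorem2:
  fixes h_c h :: "real \<Rightarrow> ennreal"
  assumes "\<forall>k\<in>{1..2}. 1 \<le> h_c k"
    and "\<forall>k\<in>{1..3}. 1 \<le> h k"
    and "antimono_on {1..2} h_c"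
    and "antimono_on {1..3} h"
    and "\<forall>k\<in>{1..2}. h_c k \<le> h k"
    and "h_c 2 = 1"
    and "h 3 = 1"
  shows "\<exists>(X :: real set) \<rho> \<mu>. metric_measure_space X \<rho> \<mu> \<and>
    (\<forall>p\<ge>1.
      (\<forall>k\<in>{1..<2}. weak_type \<mu> p (metric_measure_space.maximal_c X \<rho> \<mu> k)
         \<longleftrightarrow> p > h_c k \<or> p = \<infinity>) \<and>
      (\<forall>k\<in>{1..<3}. weak_type \<mu> p (metric_measure_space.maximal X \<rho> \<mu> k)
         \<longleftrightarrow> p > h k \<or> p = \<infinity>))"
proof -
  have a1: "1 < (2::real)" "antimono_on {1..<2} h_c" "\<forall>k\<in>{1..<2}. 1 \<le> h_c k"
    using assms by (auto simp: monotone_on_def)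
  obtain b1 P1 d1 :: "nat \<Rightarrow> real" where s1: "\<And>t. 1 < b1 t" "\<And>t. b1 t \<le> 2" "\<And>t. 1 < P1 t" "\<And>t. 0 < d1 t"
    and finite1: "\<And>k p. k \<in> {1..<2} \<Longrightarrow> h_c k < ennreal p \<Longrightarrow> finite {t. k < b1 t \<and> p < P1 t}"
    and infinite1: "\<And>k p n. k \<in> {1..<2} \<Longrightarrow> ennreal p \<le> h_c k \<Longrightarrow> \<exists>t\<ge>n. k < b1 t \<and> p + d1 t \<le> P1 t"
  proof (rule step_approximation[OF a1(2,1,3)], goal_cases)
    case (1 b P d)
    show thesis by (rule that[of b P d]) (fact 1)+
  qed
  have a2: "1 < (3::real)" "antimono_on {1..<3} h" "\<forall>k\<in>{1..<3}. 1 \<le> h k"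
    using assms by (auto simp: monotone_on_def)
  obtain b2 P2 d2 :: "nat \<Rightarrow> real" where s2: "\<And>t. 1 < b2 t" "\<And>t. b2 t \<le> 3" "\<And>t. 1 < P2 t" "\<And>t. 0 < d2 t"
    and finite2: "\<And>k p. k \<in> {1..<3} \<Longrightarrow> h k < ennreal p \<Longrightarrow> finite {t. k < b2 t \<and> p < P2 t}"
    and infinite2: "\<And>k p n. k \<in> {1..<3} \<Longrightarrow> ennreal p \<le> h k \<Longrightarrow> \<exists>t\<ge>n. k < b2 t \<and> p + d2 t \<le> P2 t"
  proof (rule step_approximation[OF a2(2,1,3)], goal_cases)
    case (1 b P d)
    show thesis by (rule that[of b P d]) (fact 1)+
  qed
  \<comment> \<open>Even blocks are central and realise \<open>h_c\<close>; odd blocks are bad only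
    for the non-centered operator and realise \<open>h\<close>.\<close>
  define b where "b t = (if even t then b1 (t div 2) else b2 (t div 2))" for t
  define P where "P t = (if even t then P1 (t div 2) else P2 (t div 2))" for t
  define d where "d t = (if even t then d1 (t div 2) else d2 (t div 2))" for t
  define W where "W t = real (Suc t) powr (P t / d t)" for t
  \<comment> \<open>Rounding up costs at most a factor 2, because the rounded number is at least
    1.\<close>
  define N where "N t = nat \<lceil>W t powr (P t - 1)\<rceil>" for t
  have P: "1 < P t" and d: "0 < d t" for t using s1 s2 by (auto simp: P_def d_def)
  have W: "1 \<le> W t" for t
    unfolding W_def using P[of t] d[of t] by (intro ge_one_powr_ge_zero) (auto intro: divide_nonneg_nonneg)
  have WP: "1 \<le> W t powr (P t - 1)" for t using W[of t] P[of t] by (intro ge_one_powr_ge_zero) auto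
  have N: "W t powr (P t - 1) \<le> real (N t)" "real (N t) \<le> 2 * W t powr (P t - 1)" for t
    using WP[of t] unfolding N_def by linarith+
  interpret growing_star_blocks N W b even P d
  proof
    show "0 < N t" for t using N(1)[of t] WP[of t] by linarith
    show "1 < b t" "b t \<le> 3" for t using s1 s2 order_trans[OF s1(2), of 3] by (auto simp: b_def)
    show "b t \<le> 2" if "even t" for t using that s1 by (simp add: b_def)
  qed (use P d W N in \<open>auto simp: W_def\<close>)
  have cases_p: "p = \<infinity> \<or> (\<exists>q\<ge>1. p = ennreal q)" if "1 \<le> p" for p :: ennreal
    using that by (cases p) auto
  have c: "weak_type \<mu> p (maximal_c k) \<longleftrightarrow> p > h_c k \<or> p = \<infinity>" if p: "1 \<le> p" and k: "k \<in> {1..<2}" for p k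
  proof (cases "p = \<infinity>")
    case True
    then show ?thesis using weak_type_infinity[OF ball_dominated_maximal_c[of k]] k by simp
  next
    case False
    then obtain q where q: "1 \<le> q" "p = ennreal q" using cases_p[OF p] by blast
    have "weak_type \<mu> (ennreal q) (maximal_c k)" if "h_c k < ennreal q"
    proof (rule weak_type_if_finite[OF ball_dominated_maximal_c])
      have "{t. k < b t \<and> (True \<longrightarrow> even t) \<and> q < P t} \<subseteq> (\<lambda>t. 2 * t) ` {t. k < b1 t \<and> q < P1 t}"
        by (auto simp: b_def P_def elim!: evenE)
      then show "finite {t. k < b t \<and> (True \<longrightarrow> even t) \<and> q < P t}"
        by (rule finite_subset) (use finite1[OF k that] in simp)
    qed (use k q in auto)
    moreover have "\<not> weak_type \<mu> (ennreal q) (maximal_c k)" if "ennreal q \<le> h_c k"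
    proof (rule not_weak_type_if_infinite[OF q(1)])
      fix n
      obtain t where t: "n \<le> t" "k < b1 t" "q + d1 t \<le> P1 t" using infinite1[OF k \<open>ennreal q \<le> h_c k\<close>] by blast
      then show "\<exists>t\<ge>n. q + d t \<le> P t \<and>
          (\<forall>i<N t. ennreal (1 / (2 + W t)) \<le> maximal_c k (indicator {enc (Hub t)}) (enc (Leaf t i)))"
        using k by (intro exI[of _ "2 * t"]) (auto intro!: maximal_c_hub simp: b_def d_def P_def)
    qed
    ultimately show ?thesis using q by (auto simp: not_less[symmetric])
  qed
  have nc: "weak_type \<mu> p (maximal k) \<longleftrightarrow> p > h k \<or> p = \<infinity>" if p: "1 \<le> p" and k: "k \<in> {1..<3}" for p k
  proof (cases "p = \<infinity>")
    case True
    then show ?thesis using weak_type_infinity[OF ball_dominated_maximal[of k]] k by simp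
  next
    case False
    then obtain q where q: "1 \<le> q" "p = ennreal q" using cases_p[OF p] by blast
    have "weak_type \<mu> (ennreal q) (maximal k)" if hq: "h k < ennreal q"
    proof (rule weak_type_if_finite[OF ball_dominated_maximal])
      \<comment> \<open>Central blocks also affect the non-centered operator. For
        \<open>k < 2\<close> only finitely many do, since
        \<open>h_c k \<le> h k < ennreal q\<close>; for \<open>k \<ge> 2\<close> none does, since
        \<open>b1 t \<le> 2\<close>.\<close>
      have "finite {t. k < b1 t \<and> q < P1 t}"
      proof (cases "k < 2")
        case True
        then show ?thesis using assms(5) k hq by (intro finite1) (auto intro: le_less_trans)
      next
        case False
        then have "\<not> k < b1 t" for t using s1(2)[of t] by simp
        then show ?thesis by simp
      qed
      moreover have "{t. k < b t \<and> (False \<longrightarrow> even t) \<and> q < P t}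
          \<subseteq> (\<lambda>t. 2 * t) ` {t. k < b1 t \<and> q < P1 t} \<union> (\<lambda>t. 2 * t + 1) ` {t. k < b2 t \<and> q < P2 t}"
      proof
        fix t assume "t \<in> {t. k < b t \<and> (False \<longrightarrow> even t) \<and> q < P t}"
        then show "t \<in> (\<lambda>t. 2 * t) ` {t. k < b1 t \<and> q < P1 t} \<union> (\<lambda>t. 2 * t + 1) ` {t. k < b2 t \<and> q < P2 t}"
          by (cases "even t") (auto simp: b_def P_def elim!: evenE oddE)
      qed
      ultimately show "finite {t. k < b t \<and> (False \<longrightarrow> even t) \<and> q < P t}"
        using finite2[OF k hq] by (meson finite_UnI finite_imageI finite_subset)
    qed (use k q in auto)
    moreover have "\<not> weak_type \<mu> (ennreal q) (maximal k)" if "ennreal q \<le> h k"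
    proof (rule not_weak_type_if_infinite[OF q(1)])
      fix n
      obtain t where t: "n \<le> t" "k < b2 t" "q + d2 t \<le> P2 t" using infinite2[OF k \<open>ennreal q \<le> h k\<close>] by blast
      then show "\<exists>t\<ge>n. q + d t \<le> P t \<and>
          (\<forall>i<N t. ennreal (1 / (2 + W t)) \<le> maximal k (indicator {enc (Hub t)}) (enc (Leaf t i)))"
        using k by (intro exI[of _ "2 * t + 1"]) (auto intro!: maximal_hub simp: b_def d_def P_def)
    qed
    ultimately show ?thesis using q by (auto simp: not_less[symmetric])
  qed
  show ?thesis
    using c nc metric_measure_space_axioms by (intro exI[of _ X] exI[of _ \<rho>] exI[of _ \<mu>]) auto
qed

end
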